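(* Let $T$ be a left multiplier bimonad on a monoidal category $\mathcal C$. Assume that $T_0:TI\to I$ and, for any objects $X$ and $Y$, the morphism $$T(TX\otimes TY)\xrightarrow{\ \overleftarrow{T}_2\ }T^2X\otimes TY\xrightarrow{\ \overleftarrow{T}_2\otimes 1\ }TI\otimes TX\otimes TY\xrightarrow{\ T_0\otimes 1\otimes 1\ }TX\otimes TY$$ are split epimorphisms. Then the $T$-modules constitute a monoidal category such that the evident forgetful functor to $\mathcal C$, $(Q,\overleftarrow{q})\mapsto Q$, is strict monoidal.
   Context: Conventions: $\otimes$ is the monoidal product, $I$ the unit; composition is juxtaposition, $1$ denotes identities, associativity and unit isomorphisms are suppressed. A *left multiplier bimonad* on $\mathcal C$ is a functor $T:\mathcal C\to\mathcal C$ with a natural transformation $\overleftarrow{T}_2:T(X\otimes TY)\to TX\otimes TY$ (natural in $X,Y$) and a morphism $T_0:TI\to I$ such that for all objects $X,Y,Z$: - $(\overleftarrow{T}_2\otimes 1)\,\overleftarrow{T}_2\,T(1\otimes\overleftarrow{T}_2)=(1\otimes\overleftarrow{T}_2)\,\overleftarrow{T}_2$ as morphisms $T(X\otimes T(Y\otimes TZ))\to TX\otimes TY\otimes TZ$; - $(1\otimes T_0)\,\overleftarrow{T}_2=T(1\otimes T_0):T(X\otimes TI)\to TX$. (In the displayed composite of the claim, the first $\overleftarrow{T}_2$ is taken at the pair $(TX,Y)$ and the second at the pair $(I,X)$.) A *$T$-module* is an object $Q$ together with a natural transformation $\overleftarrow{q}:T(-\otimes Q)\to T(-)\otimes Q$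 such that - $(\overleftarrow{T}_2\otimes 1)\,\overleftarrow{q}\,T(1\otimes\overleftarrow{q})=(1\otimes\overleftarrow{q})\,\overleftarrow{T}_2$ as morphisms $T(X\otimes T(Y\otimes Q))\to TX\otimes TY\otimes Q$, for all objects $X,Y$; - the composite $TQ\xrightarrow{\overleftarrow{q}}TI\otimes Q\xrightarrow{T_0\otimes 1}Q$ is a split epimorphism. A *morphism* of $T$-modules $(Q,\overleftarrow{q})\to(R,\overleftarrow{r})$ is a morphism $f:Q\to R$ in $\mathcal C$ with $(1\otimes f)\overleftarrow{q}=\overleftarrow{r}\,T(1\otimes f):T(X\otimes Q)\to TX\otimes R$ for all objects $X$. *)

theory Defs
  imports "HOL-Library.FuncSet"
begin

section \<open>Categories\<close>

text \<open>Composition is written in the usual order: \<open>g \<cdot> f\<close> means \<open>f\<close> first. It is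
  meaningful only for arrows with \<open>Cod f = Dom g\<close>.\<close>

record ('o, 'm) cat =
  Obj :: "'o set"
  Arr :: "'m set"
  Dom :: "'m \<Rightarrow> 'o"
  Cod :: "'m \<Rightarrow> 'o"
  Ide :: "'o \<Rightarrow> 'm" ("\<one>\<index>")
  Comp :: "'m \<Rightarrow> 'm \<Rightarrow> 'm" (infixl "\<cdot>\<index>" 55)

definition hom :: "('o, 'm, 'z) cat_scheme \<Rightarrow> 'o \<Rightarrow> 'o \<Rightarrow> 'm set" where
  "hom C X Y = {f \<in> Arr C. Dom C f = X \<and> Cod C f = Y}"

locale category =
  fixes C (structure)
  assumes Dom_Obj: "f \<in> Arr C \<Longrightarrow> Dom C f \<in> Obj C"
    and Cod_Obj: "f \<in> Arr C \<Longrightarrow> Cod C f \<in> Obj C"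
    and Ide_hom: "X \<in> Obj C \<Longrightarrow> \<one> X \<in> hom C X X"
    and Comp_hom: "\<lbrakk>f \<in> hom C X Y; g \<in> hom C Y Z\<rbrakk> \<Longrightarrow> g \<cdot> f \<in> hom C X Z"
    and Comp_Ide_left: "f \<in> hom C X Y \<Longrightarrow> \<one> Y \<cdot> f = f"
    and Comp_Ide_right: "f \<in> hom C X Y \<Longrightarrow> f \<cdot> \<one> X = f"
    and Comp_assoc: "\<lbrakk>f \<in> hom C W X; g \<in> hom C X Y; h \<in> hom C Y Z\<rbrakk>
      \<Longrightarrow> (h \<cdot> g) \<cdot> f = h \<cdot> (g \<cdot> f)"

definition inverse_arrows :: "('o, 'm, 'z) cat_scheme \<Rightarrow> 'm \<Rightarrow> 'm \<Rightarrow> bool" where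
  "inverse_arrows C f g \<longleftrightarrow> f \<in> Arr C \<and> g \<in> hom C (Cod C f) (Dom C f) \<and>
     Comp C g f = Ide C (Dom C f) \<and> Comp C f g = Ide C (Cod C f)"

definition iso_arrow :: "('o, 'm, 'z) cat_scheme \<Rightarrow> 'm \<Rightarrow> bool" where
  "iso_arrow C f \<longleftrightarrow> (\<exists>g. inverse_arrows C f g)"

definition inv_arrow :: "('o, 'm, 'z) cat_scheme \<Rightarrow> 'm \<Rightarrow> 'm" where
  "inv_arrow C f = (THE g. inverse_arrows C f g)"

definition split_epi :: "('o, 'm, 'z) cat_scheme \<Rightarrow> 'm \<Rightarrow> bool" where
  "split_epi C f \<longleftrightarrow> f \<in> Arr C \<and>
     (\<exists>g \<in> hom C (Cod C f) (Dom C f). Comp C f g = Ide C (Cod C f))"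

record ('o, 'm, 'p, 'n) cat_functor =
  fobj :: "'o \<Rightarrow> 'p"
  farr :: "'m \<Rightarrow> 'n"

locale functor_between = A: category A + B: category B for A B +
  fixes F
  assumes fobj_Obj: "X \<in> Obj A \<Longrightarrow> fobj F X \<in> Obj B"
    and farr_hom: "f \<in> hom A X Y \<Longrightarrow> farr F f \<in> hom B (fobj F X) (fobj F Y)"
    and farr_Ide: "X \<in> Obj A \<Longrightarrow> farr F (Ide A X) = Ide B (fobj F X)"
    and farr_Comp: "\<lbrakk>f \<in> hom A X Y; g \<in> hom A Y Z\<rbrakk>
      \<Longrightarrow> farr F (Comp A g f) = Comp B (farr F g) (farr F f)"

section \<open>Monoidal categories\<close>

text \<open>The monoidal product is \<open>\<odot>\<close> on objects and \<open>\<otimes>\<close> on arrows. The associativity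
  isomorphisms are oriented as in Mac Lane's book,
  \<open>\<aa> X Y Z : X \<odot> (Y \<odot> Z) \<rightarrow> (X \<odot> Y) \<odot> Z\<close>; the unit isomorphisms are
  \<open>\<ll> X : \<I> \<odot> X \<rightarrow> X\<close> and \<open>\<rr> X : X \<odot> \<I> \<rightarrow> X\<close>.\<close>

record ('o, 'm) monoidal_cat = "('o, 'm) cat" +
  TensorO :: "'o \<Rightarrow> 'o \<Rightarrow> 'o" (infixl "\<odot>\<index>" 70)
  TensorA :: "'m \<Rightarrow> 'm \<Rightarrow> 'm" (infixl "\<otimes>\<index>" 70)
  UnitO :: "'o" ("\<I>\<index>")
  Assoc :: "'o \<Rightarrow> 'o \<Rightarrow> 'o \<Rightarrow> 'm" ("\<aa>\<index>")
  Lunit :: "'o \<Rightarrow> 'm" ("\<ll>\<index>")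
  Runit :: "'o \<Rightarrow> 'm" ("\<rr>\<index>")

locale monoidal_category = category C for C (structure) +
  assumes TensorO_Obj: "\<lbrakk>X \<in> Obj C; Y \<in> Obj C\<rbrakk> \<Longrightarrow> X \<odot> Y \<in> Obj C"
    and TensorA_hom: "\<lbrakk>f \<in> hom C X X'; g \<in> hom C Y Y'\<rbrakk> \<Longrightarrow> f \<otimes> g \<in> hom C (X \<odot> Y) (X' \<odot> Y')"
    and TensorA_Ide: "\<lbrakk>X \<in> Obj C; Y \<in> Obj C\<rbrakk> \<Longrightarrow> \<one> X \<otimes> \<one> Y = \<one> (X \<odot> Y)"
    and TensorA_Comp: "\<lbrakk>f \<in> hom C X X'; f' \<in> hom C X' X''; g \<in> hom C Y Y'; g' \<in> hom C Y' Y''\<rbrakk>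
      \<Longrightarrow> (f' \<cdot> f) \<otimes> (g' \<cdot> g) = (f' \<otimes> g') \<cdot> (f \<otimes> g)"
    and UnitO_Obj: "\<I> \<in> Obj C"
    and Assoc_hom: "\<lbrakk>X \<in> Obj C; Y \<in> Obj C; Z \<in> Obj C\<rbrakk>
      \<Longrightarrow> \<aa> X Y Z \<in> hom C (X \<odot> (Y \<odot> Z)) ((X \<odot> Y) \<odot> Z)"
    and Assoc_iso: "\<lbrakk>X \<in> Obj C; Y \<in> Obj C; Z \<in> Obj C\<rbrakk> \<Longrightarrow> iso_arrow C (\<aa> X Y Z)"
    and Assoc_natural: "\<lbrakk>f \<in> hom C X X'; g \<in> hom C Y Y'; h \<in> hom C Z Z'\<rbrakk>
      \<Longrightarrow> \<aa> X' Y' Z' \<cdot> (f \<otimes> (g \<otimes> h)) = ((f \<otimes> g) \<otimes> h) \<cdot> \<aa> X Y Z"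
    and Lunit_hom: "X \<in> Obj C \<Longrightarrow> \<ll> X \<in> hom C (\<I> \<odot> X) X"
    and Lunit_iso: "X \<in> Obj C \<Longrightarrow> iso_arrow C (\<ll> X)"
    and Lunit_natural: "f \<in> hom C X X' \<Longrightarrow> \<ll> X' \<cdot> (\<one> \<I> \<otimes> f) = f \<cdot> \<ll> X"
    and Runit_hom: "X \<in> Obj C \<Longrightarrow> \<rr> X \<in> hom C (X \<odot> \<I>) X"
    and Runit_iso: "X \<in> Obj C \<Longrightarrow> iso_arrow C (\<rr> X)"
    and Runit_natural: "f \<in> hom C X X' \<Longrightarrow> \<rr> X' \<cdot> (f \<otimes> \<one> \<I>) = f \<cdot> \<rr> X"
    and pentagon: "\<lbrakk>W \<in> Obj C; X \<in> Obj C; Y \<in> Obj C; Z \<in> Obj C\<rbrakk>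
      \<Longrightarrow> \<aa> (W \<odot> X) Y Z \<cdot> \<aa> W X (Y \<odot> Z)
          = (\<aa> W X Y \<otimes> \<one> Z) \<cdot> \<aa> W (X \<odot> Y) Z \<cdot> (\<one> W \<otimes> \<aa> X Y Z)"
    and triangle: "\<lbrakk>X \<in> Obj C; Y \<in> Obj C\<rbrakk>
      \<Longrightarrow> (\<rr> X \<otimes> \<one> Y) \<cdot> \<aa> X \<I> Y = \<one> X \<otimes> \<ll> Y"

locale strict_monoidal_functor =
  A: monoidal_category A + B: monoidal_category B + functor_between A B F for A B F +
  assumes fobj_TensorO: "\<lbrakk>X \<in> Obj A; Y \<in> Obj A\<rbrakk>
      \<Longrightarrow> fobj F (TensorO A X Y) = TensorO B (fobj F X) (fobj F Y)"
    and farr_TensorA: "\<lbrakk>f \<in> Arr A; g \<in> Arr A\<rbrakk>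
      \<Longrightarrow> farr F (TensorA A f g) = TensorA B (farr F f) (farr F g)"
    and fobj_UnitO: "fobj F (UnitO A) = UnitO B"
    and farr_Assoc: "\<lbrakk>X \<in> Obj A; Y \<in> Obj A; Z \<in> Obj A\<rbrakk>
      \<Longrightarrow> farr F (Assoc A X Y Z) = Assoc B (fobj F X) (fobj F Y) (fobj F Z)"
    and farr_Lunit: "X \<in> Obj A \<Longrightarrow> farr F (Lunit A X) = Lunit B (fobj F X)"
    and farr_Runit: "X \<in> Obj A \<Longrightarrow> farr F (Runit A X) = Runit B (fobj F X)"

section \<open>Left multiplier bimonads\<close>

text \<open>\<open>mult2 T X Y : T (X \<odot> T Y) \<rightarrow> T X \<odot> T Y\<close> and \<open>mult0 T : T \<I> \<rightarrow> \<I>\<close>. From here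
  on, the associativity and unit isomorphisms that are customarily suppressed are inserted
  explicitly.\<close>

record ('o, 'm) multiplier_bimonad = "('o, 'm, 'o, 'm) cat_functor" +
  mult2 :: "'o \<Rightarrow> 'o \<Rightarrow> 'm"
  mult0 :: "'m"

locale left_multiplier_bimonad =
  monoidal_category C + T: functor_between C C T for C (structure) and T +
  assumes mult2_hom: "\<lbrakk>X \<in> Obj C; Y \<in> Obj C\<rbrakk>
      \<Longrightarrow> mult2 T X Y \<in> hom C (fobj T (X \<odot> fobj T Y)) (fobj T X \<odot> fobj T Y)"
    and mult2_natural: "\<lbrakk>f \<in> hom C X X'; g \<in> hom C Y Y'\<rbrakk>
      \<Longrightarrow> mult2 T X' Y' \<cdot> farr T (f \<otimes> farr T g) = (farr T f \<otimes> farr T g) \<cdot> mult2 T X Y"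
    and mult0_hom: "mult0 T \<in> hom C (fobj T \<I>) \<I>"
    and mult2_mult2: "\<lbrakk>X \<in> Obj C; Y \<in> Obj C; Z \<in> Obj C\<rbrakk>
      \<Longrightarrow> (mult2 T X Y \<otimes> \<one> (fobj T Z)) \<cdot> mult2 T (X \<odot> fobj T Y) Z
            \<cdot> farr T (\<aa> X (fobj T Y) (fobj T Z)) \<cdot> farr T (\<one> X \<otimes> mult2 T Y Z)
          = \<aa> (fobj T X) (fobj T Y) (fobj T Z) \<cdot> (\<one> (fobj T X) \<otimes> mult2 T Y Z)
            \<cdot> mult2 T X (Y \<odot> fobj T Z)"
    and mult0_mult2: "X \<in> Obj C
      \<Longrightarrow> \<rr> (fobj T X) \<cdot> (\<one> (fobj T X) \<otimes> mult0 T) \<cdot> mult2 T X \<I>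
          = farr T (\<rr> X) \<cdot> farr T (\<one> X \<otimes> mult0 T)"

text \<open>The arrow \<open>T (T X \<odot> T Y) \<rightarrow> T X \<odot> T Y\<close> given by \<open>mult2\<close> at \<open>(T X, Y)\<close>,
  then \<open>mult2 \<otimes> 1\<close> at \<open>(\<I>, X)\<close>, then \<open>mult0 \<otimes> 1 \<otimes> 1\<close>.\<close>

definition double_mult2 ::
  "('o, 'm, 'z) monoidal_cat_scheme \<Rightarrow> ('o, 'm, 'y) multiplier_bimonad_scheme \<Rightarrow> 'o \<Rightarrow> 'o \<Rightarrow> 'm"
where
  "double_mult2 C T X Y =
     (Lunit C (fobj T X) \<otimes>\<^bsub>C\<^esub> \<one>\<^bsub>C\<^esub> (fobj T Y))
     \<cdot>\<^bsub>C\<^esub> ((mult0 T \<otimes>\<^bsub>C\<^esub> \<one>\<^bsub>C\<^esub> (fobj T X)) \<otimes>\<^bsub>C\<^esub> \<one>\<^bsub>C\<^esub> (fobj T Y))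
     \<cdot>\<^bsub>C\<^esub> (mult2 T (UnitO C) X \<otimes>\<^bsub>C\<^esub> \<one>\<^bsub>C\<^esub> (fobj T Y))
     \<cdot>\<^bsub>C\<^esub> (farr T (inv_arrow C (Lunit C (fobj T X))) \<otimes>\<^bsub>C\<^esub> \<one>\<^bsub>C\<^esub> (fobj T Y))
     \<cdot>\<^bsub>C\<^esub> mult2 T (fobj T X) Y"

section \<open>Modules over a left multiplier bimonad\<close>

text \<open>\<open>q X : T (X \<odot> Q) \<rightarrow> T X \<odot> Q\<close>. The family \<open>q\<close> is required to be \<open>undefined\<close> outside
  the objects, so that two modules are equal as soon as their natural transformations agree.\<close>

locale T_module = left_multiplier_bimonad C T for C (structure) and T +
  fixes Q :: 'a and q :: "'a \<Rightarrow> 'b"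
  assumes carrier_Obj: "Q \<in> Obj C"
    and q_extensional: "q \<in> extensional (Obj C)"
    and q_hom: "X \<in> Obj C \<Longrightarrow> q X \<in> hom C (fobj T (X \<odot> Q)) (fobj T X \<odot> Q)"
    and q_natural: "f \<in> hom C X X'
      \<Longrightarrow> q X' \<cdot> farr T (f \<otimes> \<one> Q) = (farr T f \<otimes> \<one> Q) \<cdot> q X"
    and q_mult2: "\<lbrakk>X \<in> Obj C; Y \<in> Obj C\<rbrakk>
      \<Longrightarrow> (mult2 T X Y \<otimes> \<one> Q) \<cdot> q (X \<odot> fobj T Y)
            \<cdot> farr T (\<aa> X (fobj T Y) Q) \<cdot> farr T (\<one> X \<otimes> q Y)
          = \<aa> (fobj T X) (fobj T Y) Q \<cdot> (\<one> (fobj T X) \<otimes> q Y) \<cdot> mult2 T X (Y \<odot> Q)"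
    and q_split_epi:
      "split_epi C (\<ll> Q \<cdot> (mult0 T \<otimes> \<one> Q) \<cdot> q \<I> \<cdot> farr T (inv_arrow C (\<ll> Q)))"

definition T_module_arrow ::
  "('o, 'm, 'z) monoidal_cat_scheme \<Rightarrow> ('o, 'm, 'y) multiplier_bimonad_scheme \<Rightarrow>
   'o \<times> ('o \<Rightarrow> 'm) \<Rightarrow> 'm \<Rightarrow> 'o \<times> ('o \<Rightarrow> 'm) \<Rightarrow> bool"
where
  "T_module_arrow C T = (\<lambda>(Q, q) f (R, r). f \<in> hom C Q R \<and>
     (\<forall>X \<in> Obj C. (\<one>\<^bsub>C\<^esub> (fobj T X) \<otimes>\<^bsub>C\<^esub> f) \<cdot>\<^bsub>C\<^esub> q X
        = r X \<cdot>\<^bsub>C\<^esub> farr T (\<one>\<^bsub>C\<^esub> X \<otimes>\<^bsub>C\<^esub> f)))"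

text \<open>The same arrow of \<open>C\<close> may be a morphism between several pairs of modules, hence the
  arrows of the category of modules carry their domain and codomain.\<close>

definition T_modules ::
  "('o, 'm, 'z) monoidal_cat_scheme \<Rightarrow> ('o, 'm, 'y) multiplier_bimonad_scheme \<Rightarrow>
   ('o \<times> ('o \<Rightarrow> 'm), ('o \<times> ('o \<Rightarrow> 'm)) \<times> 'm \<times> ('o \<times> ('o \<Rightarrow> 'm))) cat"
where
  "T_modules C T =
    \<lparr>Obj = {(Q, q). T_module C T Q q},
     Arr = {(M, f, N). case_prod (T_module C T) M \<and> case_prod (T_module C T) N \<and>
                       T_module_arrow C T M f N},
     Dom = (\<lambda>(M, f, N). M),
     Cod = (\<lambda>(M, f, N). N),
     Ide = (\<lambda>M. (M, Ide C (fst M), M)),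
     Comp = (\<lambda>(N', g, P) (M, f, N). (M, Comp C g f, P))\<rparr>"

definition forgetful ::
  "('o \<times> ('o \<Rightarrow> 'm), ('o \<times> ('o \<Rightarrow> 'm)) \<times> 'm \<times> ('o \<times> ('o \<Rightarrow> 'm)), 'o, 'm) cat_functor"
where
  "forgetful = \<lparr>fobj = fst, farr = (\<lambda>(M, f, N). f)\<rparr>"

end

theory Submission
  imports Defs
begin

text \<open>With the associativity and unit isomorphisms suppressed, the tensor product of two modules
  \<open>(Q, q)\<close> and \<open>(R, r)\<close> is \<open>Q \<odot> R\<close> with the family
  \<open>T (X \<odot> Q \<odot> R) \<rightarrow> T (X \<odot> Q) \<odot> R \<rightarrow> T X \<odot> Q \<odot> R\<close>, first \<open>r\<close> at \<open>X \<odot> Q\<close>, then \<open>q \<otimes> 1\<close>.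
  The unit is \<open>\<I>\<close> with the identities \<open>T X \<rightarrow> T X\<close>. Naturality, the compatibility with
  \<open>mult2\<close> (\<open>qr_mult2\<close>) and the fact that the structure isomorphisms of \<open>C\<close> are module morphisms
  then follow from naturality of the families and their own compatibility with \<open>mult2\<close>.

  The one axiom with content is that the induced action \<open>T (Q \<odot> R) \<rightarrow> Q \<odot> R\<close> is a split
  epimorphism. Write \<open>\<psi>\<^sub>Q : T Q \<rightarrow> Q\<close> for the action on \<open>Q\<close>. It is a morphism of modules from
  \<open>(T Q, mult2 T - Q)\<close> to \<open>(Q, q)\<close> (\<open>action_T_module_arrow\<close>), so \<open>\<psi>\<^sub>Q \<otimes> \<psi>\<^sub>R\<close> is one from
  \<open>T Q \<odot> T R\<close> to \<open>Q \<odot> R\<close> (\<open>tensor_T_module_arrow\<close>). Module morphisms commute with actions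
  (\<open>action_natural\<close>), and the action on \<open>T Q \<odot> T R\<close> is exactly \<open>double_mult2 C T Q R\<close> by
  \<open>action_tensor\<close>; hence
  \<open>\<psi>\<^bsub>Q \<odot> R\<^esub> \<cdot> T (\<psi>\<^sub>Q \<otimes> \<psi>\<^sub>R) = (\<psi>\<^sub>Q \<otimes> \<psi>\<^sub>R) \<cdot> double_mult2 C T Q R\<close>. The right-hand side is a
  composite of split epimorphisms, so \<open>\<psi>\<^bsub>Q \<odot> R\<^esub>\<close> is a split epimorphism. The action on the unit
  is \<open>mult0\<close>, which accounts for the other hypothesis.\<close>

section \<open>Categories and coherence\<close>

context category
begin

lemma in_hom: "f \<in> hom C X Y \<longleftrightarrow> f \<in> Arr C \<and> Dom C f = X \<and> Cod C f = Y"
  by (auto simp: hom_def)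

lemma Ide_simps [simp]:
  assumes "X \<in> Obj C"
  shows "\<one> X \<in> Arr C" "Dom C (\<one> X) = X" "Cod C (\<one> X) = X"
  using Ide_hom[OF assms] by (auto simp: in_hom)

lemma Comp_simps [simp]:
  assumes "f \<in> Arr C" "g \<in> Arr C" "Cod C f = Dom C g"
  shows "g \<cdot> f \<in> Arr C" "Dom C (g \<cdot> f) = Dom C f" "Cod C (g \<cdot> f) = Cod C g"
  using Comp_hom[of f "Dom C f" "Cod C f" g "Cod C g"] assms by (auto simp: in_hom)

lemma Ide_Comp [simp]: "\<lbrakk>f \<in> Arr C; Cod C f = Y\<rbrakk> \<Longrightarrow> \<one> Y \<cdot> f = f"
  using Comp_Ide_left[of f "Dom C f" Y] by (auto simp: in_hom)

lemma Comp_Ide [simp]: "\<lbrakk>f \<in> Arr C; Dom C f = X\<rbrakk> \<Longrightarrow> f \<cdot> \<one> X = f"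
  using Comp_Ide_right[of f X "Cod C f"] by (auto simp: in_hom)

lemma assoc [simp]:
  "\<lbrakk>f \<in> Arr C; g \<in> Arr C; h \<in> Arr C; Cod C f = Dom C g; Cod C g = Dom C h\<rbrakk>
    \<Longrightarrow> (h \<cdot> g) \<cdot> f = h \<cdot> (g \<cdot> f)"
  using Comp_assoc[of f "Dom C f" "Dom C g" g "Dom C h" h "Cod C h"] by (auto simp: in_hom)

declare Dom_Obj [simp] Cod_Obj [simp]

text \<open>Composites are kept bracketed to the right; this is how an equation between
  two-fold composites is applied in the middle of such a composite.\<close>

lemma Comp_extend:
  "\<lbrakk>g \<cdot> f = k; f \<in> Arr C; g \<in> Arr C; h \<in> Arr C; Cod C f = Dom C g; Cod C h = Dom C f\<rbrakk>
    \<Longrightarrow> g \<cdot> (f \<cdot> h) = k \<cdot> h"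
  using assoc[of h f g] by simp

lemma inverse_arrows_inv_arrow:
  assumes "iso_arrow C f"
  shows "inverse_arrows C f (inv_arrow C f)"
proof -
  obtain g where g: "inverse_arrows C f g"
    using assms by (auto simp: iso_arrow_def)
  have "h = g" if h: "inverse_arrows C f h" for h
  proof -
    have "h \<cdot> (f \<cdot> g) = \<one> (Dom C f) \<cdot> g"
      by (rule Comp_extend) (use g h in \<open>auto simp: inverse_arrows_def in_hom\<close>)
    then show ?thesis
      using g h by (auto simp: inverse_arrows_def in_hom)
  qed
  with g show ?thesis
    unfolding inv_arrow_def by (metis theI')
qed

lemma inv_arrow_simps:
  assumes "iso_arrow C f"
  shows "f \<in> Arr C" "inv_arrow C f \<in> Arr C" "Dom C (inv_arrow C f) = Cod C f"
    "Cod C (inv_arrow C f) = Dom C f"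
    "inv_arrow C f \<cdot> f = \<one> (Dom C f)" "f \<cdot> inv_arrow C f = \<one> (Cod C f)"
  using inverse_arrows_inv_arrow[OF assms] by (auto simp: inverse_arrows_def in_hom)

lemma iso_cancel_left:
  assumes "iso_arrow C f" "f \<cdot> g = f \<cdot> h" "g \<in> Arr C" "h \<in> Arr C"
    "Cod C g = Dom C f" "Cod C h = Dom C f"
  shows "g = h"
proof -
  note f = inv_arrow_simps[OF assms(1)]
  have "inv_arrow C f \<cdot> (f \<cdot> k) = k" if "k \<in> Arr C" "Cod C k = Dom C f" for k
    using Comp_extend[OF f(5), of k] f that by simp
  from this[of g] this[of h] show ?thesis
    using assms by metis
qed

lemma iso_cancel_right:
  assumes "iso_arrow C f" "g \<cdot> f = h \<cdot> f" "g \<in> Arr C" "h \<in> Arr C"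
    "Dom C g = Cod C f" "Dom C h = Cod C f"
  shows "g = h"
proof -
  note f = inv_arrow_simps[OF assms(1)]
  have "(k \<cdot> f) \<cdot> inv_arrow C f = k" if "k \<in> Arr C" "Dom C k = Cod C f" for k
    using f that by simp
  from this[of g] this[of h] show ?thesis
    using assms by metis
qed

text \<open>If \<open>f \<cdot> p = p' \<cdot> g\<close> with \<open>p'\<close> and \<open>g\<close> split epimorphisms, then \<open>f\<close> is one too: a
  section of \<open>p' \<cdot> g\<close>, followed by \<open>p\<close>, is a section of \<open>f\<close>.\<close>

lemma split_epi_descends:
  assumes "f \<cdot> p = p' \<cdot> g" "split_epi C p'" "split_epi C g"
    "f \<in> Arr C" "p \<in> Arr C" "Cod C p = Dom C f" "Cod C g = Dom C p'"
    "Cod C f = Cod C p'" "Dom C p = Dom C g"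
  shows "split_epi C f"
proof -
  obtain s where s: "s \<in> Arr C" "Dom C s = Cod C p'" "Cod C s = Dom C p'"
      "p' \<cdot> s = \<one> (Cod C p')" and p': "p' \<in> Arr C"
    using assms(2) by (auto simp: split_epi_def in_hom)
  obtain t where t: "t \<in> Arr C" "Dom C t = Cod C g" "Cod C t = Dom C g"
      "g \<cdot> t = \<one> (Cod C g)" and g: "g \<in> Arr C"
    using assms(3) by (auto simp: split_epi_def in_hom)
  have "f \<cdot> (p \<cdot> (t \<cdot> s)) = (p' \<cdot> g) \<cdot> (t \<cdot> s)"
    using assms s t p' g by (intro Comp_extend) auto
  also have "\<dots> = p' \<cdot> ((g \<cdot> t) \<cdot> s)"
    using assms s t(1-3) p' g by simp
  also have "\<dots> = \<one> (Cod C f)"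
    using assms s t by simp
  finally show ?thesis
    using assms s t p' g by (auto simp: split_epi_def in_hom intro!: bexI[of _ "p \<cdot> (t \<cdot> s)"])
qed

end

context monoidal_category
begin

lemma Tensor_simps [simp]:
  assumes "f \<in> Arr C" "g \<in> Arr C"
  shows "f \<otimes> g \<in> Arr C" "Dom C (f \<otimes> g) = Dom C f \<odot> Dom C g"
    "Cod C (f \<otimes> g) = Cod C f \<odot> Cod C g"
  using TensorA_hom[of f "Dom C f" "Cod C f" g "Dom C g" "Cod C g"] assms
  by (auto simp: in_hom)

declare TensorO_Obj [simp] UnitO_Obj [simp] TensorA_Ide [simp]

lemma interchange:
  "\<lbrakk>f \<in> Arr C; f' \<in> Arr C; g \<in> Arr C; g' \<in> Arr C; Cod C f = Dom C f'; Cod C g = Dom C g'\<rbrakk>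
    \<Longrightarrow> (f' \<otimes> g') \<cdot> (f \<otimes> g) = (f' \<cdot> f) \<otimes> (g' \<cdot> g)"
  using TensorA_Comp[of f "Dom C f" "Cod C f" f' "Cod C f'" g "Dom C g" "Cod C g" g' "Cod C g'"]
  by (auto simp: in_hom)

lemma Comp_whisker_right:
  "\<lbrakk>f \<in> Arr C; g \<in> Arr C; Cod C f = Dom C g; Z \<in> Obj C\<rbrakk>
    \<Longrightarrow> (g \<cdot> f) \<otimes> \<one> Z = (g \<otimes> \<one> Z) \<cdot> (f \<otimes> \<one> Z)"
  by (simp add: interchange)

lemma Comp_whisker_left:
  "\<lbrakk>f \<in> Arr C; g \<in> Arr C; Cod C f = Dom C g; Z \<in> Obj C\<rbrakk>
    \<Longrightarrow> \<one> Z \<otimes> (g \<cdot> f) = (\<one> Z \<otimes> g) \<cdot> (\<one> Z \<otimes> f)"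
  by (simp add: interchange)

lemma Assoc_simps [simp]:
  assumes "X \<in> Obj C" "Y \<in> Obj C" "Z \<in> Obj C"
  shows "\<aa> X Y Z \<in> Arr C" "Dom C (\<aa> X Y Z) = X \<odot> (Y \<odot> Z)" "Cod C (\<aa> X Y Z) = (X \<odot> Y) \<odot> Z"
    "inv_arrow C (\<aa> X Y Z) \<in> Arr C" "Dom C (inv_arrow C (\<aa> X Y Z)) = (X \<odot> Y) \<odot> Z"
    "Cod C (inv_arrow C (\<aa> X Y Z)) = X \<odot> (Y \<odot> Z)"
    "\<aa> X Y Z \<cdot> inv_arrow C (\<aa> X Y Z) = \<one> ((X \<odot> Y) \<odot> Z)"
    "inv_arrow C (\<aa> X Y Z) \<cdot> \<aa> X Y Z = \<one> (X \<odot> (Y \<odot> Z))"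
  using Assoc_hom[OF assms] inv_arrow_simps[OF Assoc_iso[OF assms]] by (auto simp: in_hom)

lemma Lunit_simps [simp]:
  assumes "X \<in> Obj C"
  shows "\<ll> X \<in> Arr C" "Dom C (\<ll> X) = \<I> \<odot> X" "Cod C (\<ll> X) = X"
    "inv_arrow C (\<ll> X) \<in> Arr C" "Dom C (inv_arrow C (\<ll> X)) = X"
    "Cod C (inv_arrow C (\<ll> X)) = \<I> \<odot> X"
    "\<ll> X \<cdot> inv_arrow C (\<ll> X) = \<one> X" "inv_arrow C (\<ll> X) \<cdot> \<ll> X = \<one> (\<I> \<odot> X)"
  using Lunit_hom[OF assms] inv_arrow_simps[OF Lunit_iso[OF assms]] by (auto simp: in_hom)

lemma Runit_simps [simp]:
  assumes "X \<in> Obj C"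
  shows "\<rr> X \<in> Arr C" "Dom C (\<rr> X) = X \<odot> \<I>" "Cod C (\<rr> X) = X"
    "inv_arrow C (\<rr> X) \<in> Arr C" "Dom C (inv_arrow C (\<rr> X)) = X"
    "Cod C (inv_arrow C (\<rr> X)) = X \<odot> \<I>"
    "\<rr> X \<cdot> inv_arrow C (\<rr> X) = \<one> X" "inv_arrow C (\<rr> X) \<cdot> \<rr> X = \<one> (X \<odot> \<I>)"
  using Runit_hom[OF assms] inv_arrow_simps[OF Runit_iso[OF assms]] by (auto simp: in_hom)

lemma Assoc_nat:
  "\<lbrakk>f \<in> Arr C; g \<in> Arr C; h \<in> Arr C; Cod C f = X; Cod C g = Y; Cod C h = Z\<rbrakk>
    \<Longrightarrow> \<aa> X Y Z \<cdot> (f \<otimes> (g \<otimes> h)) = ((f \<otimes> g) \<otimes> h) \<cdot> \<aa> (Dom C f) (Dom C g) (Dom C h)"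
  using Assoc_natural[of f "Dom C f" X g "Dom C g" Y h "Dom C h" Z] by (auto simp: in_hom)

lemma Assoc_nat_left:
  "\<lbrakk>f \<in> Arr C; Cod C f = X; Y \<in> Obj C; Z \<in> Obj C\<rbrakk>
    \<Longrightarrow> \<aa> X Y Z \<cdot> (f \<otimes> \<one> (Y \<odot> Z)) = ((f \<otimes> \<one> Y) \<otimes> \<one> Z) \<cdot> \<aa> (Dom C f) Y Z"
  using Assoc_nat[of f "\<one> Y" "\<one> Z" X Y Z] by simp

lemma Assoc_nat_middle:
  "\<lbrakk>f \<in> Arr C; X \<in> Obj C; Cod C f = Y; Z \<in> Obj C\<rbrakk>
    \<Longrightarrow> \<aa> X Y Z \<cdot> (\<one> X \<otimes> (f \<otimes> \<one> Z)) = ((\<one> X \<otimes> f) \<otimes> \<one> Z) \<cdot> \<aa> X (Dom C f) Z"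
  using Assoc_nat[of "\<one> X" f "\<one> Z" X Y Z] by simp

lemma Assoc_nat_right:
  "\<lbrakk>f \<in> Arr C; X \<in> Obj C; Y \<in> Obj C; Cod C f = Z\<rbrakk>
    \<Longrightarrow> \<aa> X Y Z \<cdot> (\<one> X \<otimes> (\<one> Y \<otimes> f)) = (\<one> (X \<odot> Y) \<otimes> f) \<cdot> \<aa> X Y (Dom C f)"
  using Assoc_nat[of "\<one> X" "\<one> Y" f X Y Z] by simp

lemma Lunit_nat: "\<lbrakk>f \<in> Arr C; Cod C f = X\<rbrakk> \<Longrightarrow> \<ll> X \<cdot> (\<one> \<I> \<otimes> f) = f \<cdot> \<ll> (Dom C f)"
  using Lunit_natural[of f "Dom C f" X] by (auto simp: in_hom)

lemma Runit_nat: "\<lbrakk>f \<in> Arr C; Cod C f = X\<rbrakk> \<Longrightarrow> \<rr> X \<cdot> (f \<otimes> \<one> \<I>) = f \<cdot> \<rr> (Dom C f)"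
  using Runit_natural[of f "Dom C f" X] by (auto simp: in_hom)

lemma pentagon_right:
  "\<lbrakk>W \<in> Obj C; X \<in> Obj C; Y \<in> Obj C; Z \<in> Obj C\<rbrakk>
    \<Longrightarrow> \<aa> (W \<odot> X) Y Z \<cdot> \<aa> W X (Y \<odot> Z)
      = (\<aa> W X Y \<otimes> \<one> Z) \<cdot> (\<aa> W (X \<odot> Y) Z \<cdot> (\<one> W \<otimes> \<aa> X Y Z))"
  using pentagon[of W X Y Z] by simp

text \<open>The functors \<open>\<I> \<odot> -\<close> and \<open>- \<odot> \<I>\<close> are faithful, being isomorphic to the identity.\<close>

lemma UnitO_Tensor_faithful:
  assumes "\<one> \<I> \<otimes> f = \<one> \<I> \<otimes> g" "f \<in> Arr C" "g \<in> Arr C" "Dom C f = Dom C g" "Cod C f = Cod C g"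
  shows "f = g"
proof (rule iso_cancel_right[of "\<ll> (Dom C f)"])
  show "f \<cdot> \<ll> (Dom C f) = g \<cdot> \<ll> (Dom C f)"
    using Lunit_nat[of f] Lunit_nat[of g] assms by metis
qed (use assms Lunit_iso in auto)

lemma Tensor_UnitO_faithful:
  assumes "f \<otimes> \<one> \<I> = g \<otimes> \<one> \<I>" "f \<in> Arr C" "g \<in> Arr C" "Dom C f = Dom C g" "Cod C f = Cod C g"
  shows "f = g"
proof (rule iso_cancel_right[of "\<rr> (Dom C f)"])
  show "f \<cdot> \<rr> (Dom C f) = g \<cdot> \<rr> (Dom C f)"
    using Runit_nat[of f] Runit_nat[of g] assms by metis
qed (use assms Runit_iso in auto)

lemma Tensor_iso:
  assumes "iso_arrow C f" "iso_arrow C g"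
  shows "iso_arrow C (f \<otimes> g)"
  unfolding iso_arrow_def inverse_arrows_def
  using inv_arrow_simps[OF assms(1)] inv_arrow_simps[OF assms(2)]
  by (intro exI[of _ "inv_arrow C f \<otimes> inv_arrow C g"]) (simp add: in_hom interchange)

lemma Comp_iso:
  assumes "iso_arrow C f" "iso_arrow C g" "Cod C f = Dom C g"
  shows "iso_arrow C (g \<cdot> f)"
proof -
  note f = inv_arrow_simps[OF assms(1)] and g = inv_arrow_simps[OF assms(2)]
  have "f \<cdot> (inv_arrow C f \<cdot> inv_arrow C g) = \<one> (Cod C f) \<cdot> inv_arrow C g"
    by (rule Comp_extend) (use f g assms in auto)
  moreover have "inv_arrow C g \<cdot> (g \<cdot> f) = \<one> (Dom C g) \<cdot> f"
    by (rule Comp_extend) (use f g assms in auto)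
  ultimately show ?thesis
    unfolding iso_arrow_def inverse_arrows_def using f g assms
    by (intro exI[of _ "inv_arrow C f \<cdot> inv_arrow C g"]) (simp add: in_hom)
qed

lemma Ide_iso: "X \<in> Obj C \<Longrightarrow> iso_arrow C (\<one> X)"
  unfolding iso_arrow_def inverse_arrows_def by (intro exI[of _ "\<one> X"]) (simp add: in_hom)

text \<open>A consequence, due to Kelly, of the pentagon and the triangle: in the pentagon for \<open>X, \<I>, Y, Z\<close>,
  the triangle replaces \<open>\<I>\<close> by unit isomorphisms, and naturality of \<open>\<aa>\<close> brings both sides into
  the form \<open>\<aa> X Y Z \<cdot> (\<one> X \<otimes> -)\<close>. For \<open>X = \<I>\<close>, both \<open>\<aa> X Y Z\<close> and \<open>\<one> X \<otimes> -\<close> can be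
  cancelled.\<close>

lemma Lunit_Tensor:
  assumes Y: "Y \<in> Obj C" and Z: "Z \<in> Obj C"
  shows "(\<ll> Y \<otimes> \<one> Z) \<cdot> \<aa> \<I> Y Z = \<ll> (Y \<odot> Z)"
proof (rule UnitO_Tensor_faithful)
  \<comment> \<open>The copy of \<open>\<I>\<close> in the role of \<open>X\<close> is kept apart from the one that is contracted.\<close>
  let ?X = "\<I>"
  let ?R = "((\<rr> ?X \<otimes> \<one> Y) \<otimes> \<one> Z)"
  show "\<one> \<I> \<otimes> ((\<ll> Y \<otimes> \<one> Z) \<cdot> \<aa> \<I> Y Z) = \<one> \<I> \<otimes> \<ll> (Y \<odot> Z)"
  proof (rule iso_cancel_left[OF Assoc_iso[of ?X Y Z]])
    have "\<aa> ?X Y Z \<cdot> (\<one> ?X \<otimes> ((\<ll> Y \<otimes> \<one> Z) \<cdot> \<aa> \<I> Y Z))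
        = (\<aa> ?X Y Z \<cdot> (\<one> ?X \<otimes> (\<ll> Y \<otimes> \<one> Z))) \<cdot> (\<one> ?X \<otimes> \<aa> \<I> Y Z)"
      using Y Z by (simp add: Comp_whisker_left)
    also have "\<dots> = ((\<one> ?X \<otimes> \<ll> Y) \<otimes> \<one> Z) \<cdot> \<aa> ?X (\<I> \<odot> Y) Z \<cdot> (\<one> ?X \<otimes> \<aa> \<I> Y Z)"
      using Y Z by (subst Assoc_nat_middle) simp_all
    also have "\<dots> = ?R \<cdot> ((\<aa> ?X \<I> Y \<otimes> \<one> Z) \<cdot> (\<aa> ?X (\<I> \<odot> Y) Z \<cdot> (\<one> ?X \<otimes> \<aa> \<I> Y Z)))"
      using Y Z by (simp add: triangle[symmetric] Comp_whisker_right)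
    also have "\<dots> = ?R \<cdot> \<aa> (?X \<odot> \<I>) Y Z \<cdot> \<aa> ?X \<I> (Y \<odot> Z)"
      using Y Z by (subst pentagon_right[symmetric]) simp_all
    also have "\<dots> = \<aa> ?X Y Z \<cdot> (\<rr> ?X \<otimes> \<one> (Y \<odot> Z)) \<cdot> \<aa> ?X \<I> (Y \<odot> Z)"
      using Y Z by (subst Assoc_nat_left) simp_all
    also have "\<dots> = \<aa> ?X Y Z \<cdot> (\<one> ?X \<otimes> \<ll> (Y \<odot> Z))"
      using Y Z by (simp add: triangle)
    finally show "\<aa> ?X Y Z \<cdot> (\<one> \<I> \<otimes> ((\<ll> Y \<otimes> \<one> Z) \<cdot> \<aa> \<I> Y Z))
        = \<aa> ?X Y Z \<cdot> (\<one> \<I> \<otimes> \<ll> (Y \<odot> Z))" .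
  qed (use Y Z in simp_all)
qed (use Y Z in simp_all)

text \<open>The mirror image, from the pentagon for \<open>X, Y, \<I>, Z\<close> with \<open>Z = \<I>\<close>.\<close>

lemma Runit_Tensor:
  assumes X: "X \<in> Obj C" and Y: "Y \<in> Obj C"
  shows "\<rr> (X \<odot> Y) \<cdot> \<aa> X Y \<I> = \<one> X \<otimes> \<rr> Y"
proof (rule Tensor_UnitO_faithful)
  let ?Z = "\<I>"
  let ?A = "\<aa> X (Y \<odot> \<I>) ?Z \<cdot> (\<one> X \<otimes> \<aa> Y \<I> ?Z)"
  show "(\<rr> (X \<odot> Y) \<cdot> \<aa> X Y \<I>) \<otimes> \<one> ?Z = (\<one> X \<otimes> \<rr> Y) \<otimes> \<one> ?Z"
  proof (rule iso_cancel_right[of ?A])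
    show "iso_arrow C ?A"
      using X Y by (intro Comp_iso Tensor_iso Assoc_iso Ide_iso) simp_all
    have "((\<rr> (X \<odot> Y) \<cdot> \<aa> X Y \<I>) \<otimes> \<one> ?Z) \<cdot> ?A
        = (\<rr> (X \<odot> Y) \<otimes> \<one> ?Z) \<cdot> ((\<aa> X Y \<I> \<otimes> \<one> ?Z) \<cdot> ?A)"
      using X Y by (simp add: Comp_whisker_right)
    also have "\<dots> = ((\<rr> (X \<odot> Y) \<otimes> \<one> ?Z) \<cdot> \<aa> (X \<odot> Y) \<I> ?Z) \<cdot> \<aa> X Y (\<I> \<odot> ?Z)"
      using X Y by (subst pentagon_right[symmetric]) simp_all
    also have "\<dots> = (\<one> (X \<odot> Y) \<otimes> \<ll> ?Z) \<cdot> \<aa> X Y (\<I> \<odot> ?Z)"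
      using X Y by (subst triangle) simp_all
    also have "\<dots> = \<aa> X Y ?Z \<cdot> (\<one> X \<otimes> (\<one> Y \<otimes> \<ll> ?Z))"
      using X Y by (subst Assoc_nat_right) simp_all
    also have "\<dots> = (\<aa> X Y ?Z \<cdot> (\<one> X \<otimes> (\<rr> Y \<otimes> \<one> ?Z))) \<cdot> (\<one> X \<otimes> \<aa> Y \<I> ?Z)"
      using X Y by (simp add: triangle[symmetric] Comp_whisker_left)
    also have "\<dots> = ((\<one> X \<otimes> \<rr> Y) \<otimes> \<one> ?Z) \<cdot> ?A"
      using X Y by (subst Assoc_nat_middle) simp_all
    finally show "((\<rr> (X \<odot> Y) \<cdot> \<aa> X Y \<I>) \<otimes> \<one> ?Z) \<cdot> ?A = ((\<one> X \<otimes> \<rr> Y) \<otimes> \<one> ?Z) \<cdot> ?A" .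
  qed (use X Y in simp_all)
qed (use X Y in simp_all)

text \<open>By naturality of \<open>\<ll>\<close> at \<open>\<ll> \<I>\<close>, the arrow \<open>\<ll> (\<I> \<odot> \<I>)\<close> is \<open>\<one> \<I> \<otimes> \<ll> \<I>\<close>; then \<open>Lunit_Tensor\<close> and
  the triangle compare \<open>\<ll> \<I> \<otimes> \<one> \<I>\<close> with \<open>\<rr> \<I> \<otimes> \<one> \<I>\<close>.\<close>

lemma Lunit_UnitO: "\<ll> \<I> = \<rr> \<I>"
proof (rule Tensor_UnitO_faithful)
  have "\<ll> (\<I> \<odot> \<I>) = \<one> \<I> \<otimes> \<ll> \<I>"
    by (rule iso_cancel_left[OF Lunit_iso[of \<I>]]) (simp_all add: Lunit_nat)
  then have "(\<ll> \<I> \<otimes> \<one> \<I>) \<cdot> \<aa> \<I> \<I> \<I> = (\<rr> \<I> \<otimes> \<one> \<I>) \<cdot> \<aa> \<I> \<I> \<I>"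
    by (simp add: Lunit_Tensor triangle)
  then show "\<ll> \<I> \<otimes> \<one> \<I> = \<rr> \<I> \<otimes> \<one> \<I>"
    by (rule iso_cancel_right[OF Assoc_iso, rotated 3]) simp_all
qed simp_all

end

section \<open>Modules without the splitting condition\<close>

context left_multiplier_bimonad
begin

abbreviation FO where "FO \<equiv> fobj T"
abbreviation F where "F \<equiv> farr T"

lemma fobj_Obj [simp]: "X \<in> Obj C \<Longrightarrow> FO X \<in> Obj C"
  by (rule T.fobj_Obj)

lemma farr_simps [simp]:
  assumes "f \<in> Arr C"
  shows "F f \<in> Arr C" "Dom C (F f) = FO (Dom C f)" "Cod C (F f) = FO (Cod C f)"
  using T.farr_hom[of f "Dom C f" "Cod C f"] assms by (auto simp: in_hom)

declare T.farr_Ide [simp]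

lemma farr_Comp:
  "\<lbrakk>f \<in> Arr C; g \<in> Arr C; Cod C f = Dom C g\<rbrakk> \<Longrightarrow> F (g \<cdot> f) = F g \<cdot> F f"
  using T.farr_Comp[of f "Dom C f" "Dom C g" g "Cod C g"] by (auto simp: in_hom)

lemma mult2_simps [simp]:
  assumes "X \<in> Obj C" "Y \<in> Obj C"
  shows "mult2 T X Y \<in> Arr C" "Dom C (mult2 T X Y) = FO (X \<odot> FO Y)"
    "Cod C (mult2 T X Y) = FO X \<odot> FO Y"
  using mult2_hom[OF assms] by (auto simp: in_hom)

lemma mult0_simps [simp]: "mult0 T \<in> Arr C" "Dom C (mult0 T) = FO \<I>" "Cod C (mult0 T) = \<I>"
  using mult0_hom by (auto simp: in_hom)

lemma mult2_nat:
  "\<lbrakk>f \<in> Arr C; g \<in> Arr C; Cod C f = X; Cod C g = Y\<rbrakk>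
    \<Longrightarrow> mult2 T X Y \<cdot> F (f \<otimes> F g) = (F f \<otimes> F g) \<cdot> mult2 T (Dom C f) (Dom C g)"
  using mult2_natural[of f "Dom C f" X g "Dom C g" Y] by (auto simp: in_hom)

text \<open>The arrow \<open>T Q \<rightarrow> Q\<close> that the splitting axiom of modules is about.\<close>

definition action :: "'a \<Rightarrow> ('a \<Rightarrow> 'b) \<Rightarrow> 'b" where
  "action Q q = \<ll> Q \<cdot> (mult0 T \<otimes> \<one> Q) \<cdot> q \<I> \<cdot> F (inv_arrow C (\<ll> Q))"

text \<open>The composite \<open>T (X \<odot> Q \<odot> R) \<rightarrow> T (X \<odot> Q) \<odot> R \<rightarrow> T X \<odot> Q \<odot> R\<close>. Families of modules are
  extensional, hence the restriction to the objects.\<close>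

definition tensor_family :: "'a \<Rightarrow> ('a \<Rightarrow> 'b) \<Rightarrow> 'a \<Rightarrow> ('a \<Rightarrow> 'b) \<Rightarrow> 'a \<Rightarrow> 'b" where
  "tensor_family Q q R r = (\<lambda>X\<in>Obj C.
     inv_arrow C (\<aa> (FO X) Q R) \<cdot> ((q X \<otimes> \<one> R) \<cdot> (r (X \<odot> Q) \<cdot> F (\<aa> X Q R))))"

text \<open>The identity of \<open>T X\<close>, with right unit isomorphisms inserted.\<close>

definition unit_family :: "'a \<Rightarrow> 'b" where
  "unit_family = (\<lambda>X\<in>Obj C. inv_arrow C (\<rr> (FO X)) \<cdot> F (\<rr> X))"

end

text \<open>Modules deprived of extensionality and of the splitting condition. Splitting is the only axiom
  whose stability under tensor products is not formal. Leaving it out allows tensor products and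
  the pairs \<open>(T X, mult2 T - X)\<close> to be treated as modules in the proof that a tensor product of
  modules satisfies it.\<close>

locale nonunital_module = left_multiplier_bimonad C T for C (structure) and T +
  fixes Q :: 'a and q :: "'a \<Rightarrow> 'b"
  assumes carrier_Obj [simp]: "Q \<in> Obj C"
    and family_hom: "X \<in> Obj C \<Longrightarrow> q X \<in> hom C (fobj T (X \<odot> Q)) (fobj T X \<odot> Q)"
    and family_natural: "f \<in> hom C X X'
      \<Longrightarrow> q X' \<cdot> farr T (f \<otimes> \<one> Q) = (farr T f \<otimes> \<one> Q) \<cdot> q X"
    and family_mult2: "\<lbrakk>X \<in> Obj C; Y \<in> Obj C\<rbrakk>
      \<Longrightarrow> (mult2 T X Y \<otimes> \<one> Q) \<cdot> q (X \<odot> fobj T Y)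
            \<cdot> farr T (\<aa> X (fobj T Y) Q) \<cdot> farr T (\<one> X \<otimes> q Y)
          = \<aa> (fobj T X) (fobj T Y) Q \<cdot> (\<one> (fobj T X) \<otimes> q Y) \<cdot> mult2 T X (Y \<odot> Q)"
begin

lemma family_simps [simp]:
  assumes "X \<in> Obj C"
  shows "q X \<in> Arr C" "Dom C (q X) = FO (X \<odot> Q)" "Cod C (q X) = FO X \<odot> Q"
  using family_hom[OF assms] by (auto simp: in_hom)

lemma family_nat:
  "\<lbrakk>f \<in> Arr C; Cod C f = X\<rbrakk> \<Longrightarrow> q X \<cdot> F (f \<otimes> \<one> Q) = (F f \<otimes> \<one> Q) \<cdot> q (Dom C f)"
  using family_natural[of f "Dom C f" X] by (auto simp: in_hom)

lemma family_mult2_right: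
  "\<lbrakk>X \<in> Obj C; Y \<in> Obj C\<rbrakk>
    \<Longrightarrow> (mult2 T X Y \<otimes> \<one> Q) \<cdot> (q (X \<odot> FO Y) \<cdot> (F (\<aa> X (FO Y) Q) \<cdot> F (\<one> X \<otimes> q Y)))
      = \<aa> (FO X) (FO Y) Q \<cdot> ((\<one> (FO X) \<otimes> q Y) \<cdot> mult2 T X (Y \<odot> Q))"
  using family_mult2[of X Y] by simp

lemma action_simps [simp]:
  "action Q q \<in> Arr C" "Dom C (action Q q) = FO Q" "Cod C (action Q q) = Q"
  by (simp_all add: action_def)

end

context left_multiplier_bimonad
begin

lemma T_module_iff:
  "T_module C T Q q \<longleftrightarrow> nonunital_module C T Q q \<and> q \<in> extensional (Obj C) \<and>
    split_epi C (action Q q)"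
  unfolding T_module_def T_module_axioms_def nonunital_module_def nonunital_module_axioms_def
    action_def
  by blast

lemma T_module_arrow_iff:
  "T_module_arrow C T (Q, q) f (R, r) \<longleftrightarrow> f \<in> Arr C \<and> Dom C f = Q \<and> Cod C f = R \<and>
     (\<forall>X\<in>Obj C. (\<one> (FO X) \<otimes> f) \<cdot> q X = r X \<cdot> F (\<one> X \<otimes> f))"
  by (simp add: T_module_arrow_def in_hom)

lemma nonunital_free:
  assumes "X \<in> Obj C"
  shows "nonunital_module C T (FO X) (\<lambda>Y. mult2 T Y X)"
proof
  fix f Y Y' assume "f \<in> hom C Y Y'"
  then show "mult2 T Y' X \<cdot> F (f \<otimes> \<one> (FO X)) = (F f \<otimes> \<one> (FO X)) \<cdot> mult2 T Y X"
    using mult2_nat[of f "\<one> X" Y' X] assms by (auto simp: in_hom)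
qed (use assms mult2_hom mult2_mult2 in auto)

text \<open>Module morphisms are equivariant: the action is made of the family at \<open>\<I>\<close>, \<open>mult0\<close> in another
  tensor factor, and left unit isomorphisms, and a module morphism commutes with all three.\<close>

lemma action_natural:
  assumes "nonunital_module C T Q q" "nonunital_module C T R r"
    and f: "T_module_arrow C T (Q, q) f (R, r)"
  shows "f \<cdot> action Q q = action R r \<cdot> F f"
proof -
  interpret Q: nonunital_module C T Q q by fact
  interpret R: nonunital_module C T R r by fact
  have [simp]: "f \<in> Arr C" "Dom C f = Q" "Cod C f = R"
    and eq: "(\<one> (FO \<I>) \<otimes> f) \<cdot> q \<I> = r \<I> \<cdot> F (\<one> \<I> \<otimes> f)"
    using f by (auto simp: T_module_arrow_iff)
  have inv: "(\<one> \<I> \<otimes> f) \<cdot> inv_arrow C (\<ll> Q) = inv_arrow C (\<ll> R) \<cdot> f"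
  proof (rule iso_cancel_left[OF Lunit_iso[of R]])
    have "\<ll> R \<cdot> ((\<one> \<I> \<otimes> f) \<cdot> inv_arrow C (\<ll> Q)) = (f \<cdot> \<ll> Q) \<cdot> inv_arrow C (\<ll> Q)"
      by (rule Comp_extend) (simp_all add: Lunit_nat)
    moreover have "\<ll> R \<cdot> (inv_arrow C (\<ll> R) \<cdot> f) = \<one> R \<cdot> f"
      by (rule Comp_extend) simp_all
    ultimately show "\<ll> R \<cdot> ((\<one> \<I> \<otimes> f) \<cdot> inv_arrow C (\<ll> Q)) = \<ll> R \<cdot> (inv_arrow C (\<ll> R) \<cdot> f)"
      by simp
  qed simp_all
  have nat: "f \<cdot> \<ll> Q = \<ll> R \<cdot> (\<one> \<I> \<otimes> f)"
    by (simp add: Lunit_nat)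
  have "f \<cdot> action Q q
      = (f \<cdot> \<ll> Q) \<cdot> ((mult0 T \<otimes> \<one> Q) \<cdot> (q \<I> \<cdot> F (inv_arrow C (\<ll> Q))))"
    by (simp add: action_def)
  also have "\<dots> = \<ll> R \<cdot> (((\<one> \<I> \<otimes> f) \<cdot> (mult0 T \<otimes> \<one> Q)) \<cdot> (q \<I> \<cdot> F (inv_arrow C (\<ll> Q))))"
    unfolding nat by simp
  also have "(\<one> \<I> \<otimes> f) \<cdot> (mult0 T \<otimes> \<one> Q) = (mult0 T \<otimes> \<one> R) \<cdot> (\<one> (FO \<I>) \<otimes> f)"
    by (simp add: interchange)
  also have "\<ll> R \<cdot> (\<dots> \<cdot> (q \<I> \<cdot> F (inv_arrow C (\<ll> Q))))
      = \<ll> R \<cdot> ((mult0 T \<otimes> \<one> R) \<cdot> (((\<one> (FO \<I>) \<otimes> f) \<cdot> q \<I>) \<cdot> F (inv_arrow C (\<ll> Q))))"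
    by simp
  also have "\<dots> = \<ll> R \<cdot> ((mult0 T \<otimes> \<one> R) \<cdot> (r \<I> \<cdot> F ((\<one> \<I> \<otimes> f) \<cdot> inv_arrow C (\<ll> Q))))"
    unfolding eq by (simp add: farr_Comp)
  also have "\<dots> = action R r \<cdot> F f"
    unfolding inv by (simp add: farr_Comp action_def)
  finally show ?thesis .
qed

text \<open>The second axiom of a bimonad enters here: put \<open>Y = \<I>\<close> in the compatibility of \<open>q\<close> with
  \<open>mult2\<close> and compose with \<open>mult0\<close> in the middle factor.\<close>

lemma action_T_module_arrow:
  assumes "nonunital_module C T Q q"
  shows "T_module_arrow C T (FO Q, \<lambda>X. mult2 T X Q) (action Q q) (Q, q)"
  unfolding T_module_arrow_iff
proof (intro conjI ballI)
  interpret Q: nonunital_module C T Q q by fact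
  show "action Q q \<in> Arr C" "Dom C (action Q q) = FO Q" "Cod C (action Q q) = Q"
    by simp_all
  fix X assume X [simp]: "X \<in> Obj C"
  let ?i = "F (inv_arrow C (\<ll> Q))"
  let ?c = "\<ll> Q \<cdot> (mult0 T \<otimes> \<one> Q)"
  have act: "action Q q = ?c \<cdot> (q \<I> \<cdot> ?i)"
    by (simp add: action_def)
  let ?g = "\<lambda>Y. \<rr> Y \<cdot> (\<one> Y \<otimes> mult0 T)"
  have c: "\<one> Y \<otimes> ?c = (?g Y \<otimes> \<one> Q) \<cdot> \<aa> Y (FO \<I>) Q" if Y [simp]: "Y \<in> Obj C" for Y
  proof -
    have "\<one> Y \<otimes> ?c = (\<rr> Y \<otimes> \<one> Q) \<cdot> (\<aa> Y \<I> Q \<cdot> (\<one> Y \<otimes> (mult0 T \<otimes> \<one> Q)))"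
      by (simp add: Comp_whisker_left triangle[symmetric])
    also have "\<dots> = (\<rr> Y \<otimes> \<one> Q) \<cdot> (((\<one> Y \<otimes> mult0 T) \<otimes> \<one> Q) \<cdot> \<aa> Y (FO \<I>) Q)"
      by (simp add: Assoc_nat_middle)
    also have "\<dots> = (?g Y \<otimes> \<one> Q) \<cdot> \<aa> Y (FO \<I>) Q"
      by (simp add: Comp_whisker_right)
    finally show ?thesis .
  qed
  let ?rest = "F (\<one> X \<otimes> q \<I>) \<cdot> F (\<one> X \<otimes> ?i)"
  have "q X \<cdot> F (\<one> X \<otimes> action Q q) = q X \<cdot> (F (\<one> X \<otimes> ?c) \<cdot> ?rest)"
    unfolding act by (simp add: Comp_whisker_left farr_Comp)
  also have "\<dots> = (q X \<cdot> F (?g X \<otimes> \<one> Q)) \<cdot> (F (\<aa> X (FO \<I>) Q) \<cdot> ?rest)"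
    unfolding c[OF X] by (simp add: farr_Comp)
  also have "\<dots> = (F (?g X) \<otimes> \<one> Q) \<cdot> (q (X \<odot> FO \<I>) \<cdot> (F (\<aa> X (FO \<I>) Q) \<cdot> ?rest))"
    by (subst Q.family_nat) simp_all
  also have "F (?g X) = ?g (FO X) \<cdot> mult2 T X \<I>"
    using mult0_mult2[of X] by (simp add: farr_Comp)
  also have "((?g (FO X) \<cdot> mult2 T X \<I>) \<otimes> \<one> Q)
        \<cdot> (q (X \<odot> FO \<I>) \<cdot> (F (\<aa> X (FO \<I>) Q) \<cdot> ?rest))
      = (?g (FO X) \<otimes> \<one> Q) \<cdot> (((mult2 T X \<I> \<otimes> \<one> Q)
        \<cdot> (q (X \<odot> FO \<I>) \<cdot> (F (\<aa> X (FO \<I>) Q) \<cdot> F (\<one> X \<otimes> q \<I>)))) \<cdot> F (\<one> X \<otimes> ?i))"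
    by (simp add: Comp_whisker_right)
  also have "\<dots> = ((?g (FO X) \<otimes> \<one> Q) \<cdot> \<aa> (FO X) (FO \<I>) Q)
      \<cdot> ((\<one> (FO X) \<otimes> q \<I>) \<cdot> (mult2 T X (\<I> \<odot> Q) \<cdot> F (\<one> X \<otimes> ?i)))"
    by (subst Q.family_mult2_right) simp_all
  also have "\<dots> = (\<one> (FO X) \<otimes> ?c)
      \<cdot> ((\<one> (FO X) \<otimes> q \<I>) \<cdot> (mult2 T X (\<I> \<odot> Q) \<cdot> F (\<one> X \<otimes> ?i)))"
    by (subst c) simp_all
  also have "mult2 T X (\<I> \<odot> Q) \<cdot> F (\<one> X \<otimes> ?i) = (\<one> (FO X) \<otimes> ?i) \<cdot> mult2 T X Q"
    using mult2_nat[of "\<one> X" "inv_arrow C (\<ll> Q)" X "\<I> \<odot> Q"] by simp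
  also have "(\<one> (FO X) \<otimes> ?c) \<cdot> ((\<one> (FO X) \<otimes> q \<I>) \<cdot> ((\<one> (FO X) \<otimes> ?i) \<cdot> mult2 T X Q))
      = (\<one> (FO X) \<otimes> action Q q) \<cdot> mult2 T X Q"
    unfolding act by (simp add: Comp_whisker_left)
  finally show "(\<one> (FO X) \<otimes> action Q q) \<cdot> mult2 T X Q = q X \<cdot> F (\<one> X \<otimes> action Q q)"
    by simp
qed

text \<open>The last equation determines the family, since \<open>\<aa>\<close> is invertible. An equation between arrows
  into \<open>T X \<odot> (Q \<odot> R)\<close> is therefore proved after composition with \<open>\<aa>\<close>, which avoids all
  computations with inverse associators; likewise for \<open>\<rr>\<close> and the unit family below.\<close>

lemma tensor_family_simps:
  fixes Q q R r
  assumes "nonunital_module C T Q q" "nonunital_module C T R r" and X: "X \<in> Obj C"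
  shows "tensor_family Q q R r X \<in> Arr C"
    "Dom C (tensor_family Q q R r X) = FO (X \<odot> (Q \<odot> R))"
    "Cod C (tensor_family Q q R r X) = FO X \<odot> (Q \<odot> R)"
    "\<aa> (FO X) Q R \<cdot> tensor_family Q q R r X = (q X \<otimes> \<one> R) \<cdot> (r (X \<odot> Q) \<cdot> F (\<aa> X Q R))"
proof -
  interpret Q: nonunital_module C T Q q by fact
  interpret R: nonunital_module C T R r by fact
  note X [simp]
  let ?t = "(q X \<otimes> \<one> R) \<cdot> (r (X \<odot> Q) \<cdot> F (\<aa> X Q R))"
  have def: "tensor_family Q q R r X = inv_arrow C (\<aa> (FO X) Q R) \<cdot> ?t"
    by (simp add: tensor_family_def)
  show "tensor_family Q q R r X \<in> Arr C"
    "Dom C (tensor_family Q q R r X) = FO (X \<odot> (Q \<odot> R))"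
    "Cod C (tensor_family Q q R r X) = FO X \<odot> (Q \<odot> R)"
    unfolding def by simp_all
  have "\<aa> (FO X) Q R \<cdot> (inv_arrow C (\<aa> (FO X) Q R) \<cdot> ?t) = \<one> ((FO X \<odot> Q) \<odot> R) \<cdot> ?t"
    by (rule Comp_extend) simp_all
  then show "\<aa> (FO X) Q R \<cdot> tensor_family Q q R r X = ?t"
    unfolding def by simp
qed

lemma unit_family_simps [simp]:
  assumes X: "X \<in> Obj C"
  shows "unit_family X \<in> Arr C" "Dom C (unit_family X) = FO (X \<odot> \<I>)"
    "Cod C (unit_family X) = FO X \<odot> \<I>"
    "\<rr> (FO X) \<cdot> unit_family X = F (\<rr> X)"
proof -
  note X [simp]
  have def: "unit_family X = inv_arrow C (\<rr> (FO X)) \<cdot> F (\<rr> X)"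
    by (simp add: unit_family_def)
  show "unit_family X \<in> Arr C" "Dom C (unit_family X) = FO (X \<odot> \<I>)"
    "Cod C (unit_family X) = FO X \<odot> \<I>"
    unfolding def by simp_all
  have "\<rr> (FO X) \<cdot> (inv_arrow C (\<rr> (FO X)) \<cdot> F (\<rr> X)) = \<one> (FO X) \<cdot> F (\<rr> X)"
    by (rule Comp_extend) simp_all
  then show "\<rr> (FO X) \<cdot> unit_family X = F (\<rr> X)"
    unfolding def by simp
qed

lemma nonunital_unit: "nonunital_module C T \<I> unit_family"
proof
  show "\<I> \<in> Obj C" by simp
  fix X assume X [simp]: "X \<in> Obj C"
  show "unit_family X \<in> hom C (FO (X \<odot> \<I>)) (FO X \<odot> \<I>)"
    by (simp add: in_hom)
next
  fix f X X' assume "f \<in> hom C X X'"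
  then have f [simp]: "f \<in> Arr C" "Dom C f = X" "Cod C f = X'" and X [simp]: "X \<in> Obj C" "X' \<in> Obj C"
    by (auto simp: in_hom)
  show "unit_family X' \<cdot> F (f \<otimes> \<one> \<I>) = (F f \<otimes> \<one> \<I>) \<cdot> unit_family X"
  proof (rule iso_cancel_left[OF Runit_iso[of "FO X'"]])
    have "\<rr> (FO X') \<cdot> (unit_family X' \<cdot> F (f \<otimes> \<one> \<I>)) = F (\<rr> X') \<cdot> F (f \<otimes> \<one> \<I>)"
      by (rule Comp_extend) simp_all
    also have "\<dots> = F (f \<cdot> \<rr> X)"
      by (simp add: farr_Comp[symmetric] Runit_nat)
    also have "\<dots> = F f \<cdot> (\<rr> (FO X) \<cdot> unit_family X)"
      by (simp add: farr_Comp)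
    also have "\<dots> = (\<rr> (FO X') \<cdot> (F f \<otimes> \<one> \<I>)) \<cdot> unit_family X"
      by (subst Runit_nat) (simp_all del: unit_family_simps(4))
    also have "\<dots> = \<rr> (FO X') \<cdot> ((F f \<otimes> \<one> \<I>) \<cdot> unit_family X)"
      by simp
    finally show "\<rr> (FO X') \<cdot> (unit_family X' \<cdot> F (f \<otimes> \<one> \<I>))
        = \<rr> (FO X') \<cdot> ((F f \<otimes> \<one> \<I>) \<cdot> unit_family X)" .
  qed simp_all
next
  fix X Y assume XY [simp]: "X \<in> Obj C" "Y \<in> Obj C"
  have r: "\<one> Z \<otimes> F (\<rr> Y) = (\<one> Z \<otimes> \<rr> (FO Y)) \<cdot> (\<one> Z \<otimes> unit_family Y)" if "Z \<in> Obj C" for Z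
    using that by (simp add: Comp_whisker_left[symmetric])
  have "(mult2 T X Y \<otimes> \<one> \<I>) \<cdot> (unit_family (X \<odot> FO Y)
        \<cdot> (F (\<aa> X (FO Y) \<I>) \<cdot> F (\<one> X \<otimes> unit_family Y)))
      = \<aa> (FO X) (FO Y) \<I> \<cdot> ((\<one> (FO X) \<otimes> unit_family Y) \<cdot> mult2 T X (Y \<odot> \<I>))"
    (is "?lhs = ?rhs")
  proof (rule iso_cancel_left[OF Runit_iso[of "FO X \<odot> FO Y"]])
    have "\<rr> (FO X \<odot> FO Y) \<cdot> ?lhs = (\<rr> (FO X \<odot> FO Y) \<cdot> (mult2 T X Y \<otimes> \<one> \<I>))
        \<cdot> (unit_family (X \<odot> FO Y) \<cdot> (F (\<aa> X (FO Y) \<I>) \<cdot> F (\<one> X \<otimes> unit_family Y)))"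
      by simp
    also have "\<dots> = mult2 T X Y \<cdot> ((\<rr> (FO (X \<odot> FO Y)) \<cdot> unit_family (X \<odot> FO Y))
        \<cdot> (F (\<aa> X (FO Y) \<I>) \<cdot> F (\<one> X \<otimes> unit_family Y)))"
      by (subst Runit_nat) (simp_all del: unit_family_simps(4))
    also have "\<dots> = mult2 T X Y \<cdot> F ((\<rr> (X \<odot> FO Y) \<cdot> \<aa> X (FO Y) \<I>) \<cdot> (\<one> X \<otimes> unit_family Y))"
      by (simp add: farr_Comp)
    also have "\<dots> = mult2 T X Y \<cdot> F (\<one> X \<otimes> F (\<rr> Y))"
      by (simp add: Runit_Tensor r)
    also have "\<dots> = (\<one> (FO X) \<otimes> F (\<rr> Y)) \<cdot> mult2 T X (Y \<odot> \<I>)"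
      using mult2_nat[of "\<one> X" "\<rr> Y" X Y] by simp
    also have "\<dots> = (\<rr> (FO X \<odot> FO Y) \<cdot> \<aa> (FO X) (FO Y) \<I>)
        \<cdot> ((\<one> (FO X) \<otimes> unit_family Y) \<cdot> mult2 T X (Y \<odot> \<I>))"
      by (simp add: Runit_Tensor r)
    also have "\<dots> = \<rr> (FO X \<odot> FO Y) \<cdot> ?rhs"
      by simp
    finally show "\<rr> (FO X \<odot> FO Y) \<cdot> ?lhs = \<rr> (FO X \<odot> FO Y) \<cdot> ?rhs" .
  qed simp_all
  then show "(mult2 T X Y \<otimes> \<one> \<I>) \<cdot> unit_family (X \<odot> FO Y)
        \<cdot> F (\<aa> X (FO Y) \<I>) \<cdot> F (\<one> X \<otimes> unit_family Y)
      = \<aa> (FO X) (FO Y) \<I> \<cdot> (\<one> (FO X) \<otimes> unit_family Y) \<cdot> mult2 T X (Y \<odot> \<I>)"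
    by simp
qed

lemma action_unit: "action \<I> unit_family = mult0 T"
proof -
  have "action \<I> unit_family = (\<rr> \<I> \<cdot> (mult0 T \<otimes> \<one> \<I>)) \<cdot> (unit_family \<I> \<cdot> F (inv_arrow C (\<rr> \<I>)))"
    by (simp add: action_def Lunit_UnitO)
  also have "\<dots> = mult0 T \<cdot> ((\<rr> (FO \<I>) \<cdot> unit_family \<I>) \<cdot> F (inv_arrow C (\<rr> \<I>)))"
    by (subst Runit_nat) (simp_all del: unit_family_simps(4))
  also have "\<dots> = mult0 T \<cdot> F (\<rr> \<I> \<cdot> inv_arrow C (\<rr> \<I>))"
    by (simp add: farr_Comp del: Runit_simps(7))
  also have "\<dots> = mult0 T"
    by simp
  finally show ?thesis .
qed

end

section \<open>Tensor products of modules\<close>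

locale nonunital_module_pair =
  Q: nonunital_module C T Q q + R: nonunital_module C T R r
  for C (structure) and T and Q :: 'a and q :: "'a \<Rightarrow> 'b" and R :: 'a and r :: "'a \<Rightarrow> 'b"
begin

abbreviation qr where "qr \<equiv> Q.tensor_family Q q R r"

lemmas qr_simps [simp] =
  Q.tensor_family_simps(1-3)[OF Q.nonunital_module_axioms R.nonunital_module_axioms]
lemmas Assoc_qr =
  Q.tensor_family_simps(4)[OF Q.nonunital_module_axioms R.nonunital_module_axioms]

lemma qr_nat:
  assumes "f \<in> Arr C" "Dom C f = X" "Cod C f = X'"
  shows "qr X' \<cdot> Q.F (f \<otimes> \<one> (Q \<odot> R)) = (Q.F f \<otimes> \<one> (Q \<odot> R)) \<cdot> qr X"
proof -
  have f [simp]: "f \<in> Arr C" "Dom C f = X" "Cod C f = X'" and X [simp]: "X \<in> Obj C" "X' \<in> Obj C"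
    using assms by auto
  let ?a = "\<aa> (Q.FO X') Q R"
  show ?thesis
  proof (rule Q.iso_cancel_left[OF Q.Assoc_iso[of "Q.FO X'" Q R]])
    have "?a \<cdot> (qr X' \<cdot> Q.F (f \<otimes> \<one> (Q \<odot> R)))
        = (?a \<cdot> qr X') \<cdot> Q.F (f \<otimes> \<one> (Q \<odot> R))"
      by simp
    also have "\<dots> = (q X' \<otimes> \<one> R) \<cdot> (r (X' \<odot> Q) \<cdot> Q.F (\<aa> X' Q R \<cdot> (f \<otimes> \<one> (Q \<odot> R))))"
      unfolding Assoc_qr[OF X(2)] by (simp add: Q.farr_Comp)
    also have "\<dots> = (q X' \<otimes> \<one> R) \<cdot> ((r (X' \<odot> Q) \<cdot> Q.F ((f \<otimes> \<one> Q) \<otimes> \<one> R)) \<cdot> Q.F (\<aa> X Q R))"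
      by (simp add: Q.Assoc_nat_left Q.farr_Comp)
    also have "\<dots> = ((q X' \<cdot> Q.F (f \<otimes> \<one> Q)) \<otimes> \<one> R) \<cdot> (r (X \<odot> Q) \<cdot> Q.F (\<aa> X Q R))"
      by (subst R.family_nat) (simp_all add: Q.Comp_whisker_right)
    also have "\<dots> = ((Q.F f \<otimes> \<one> Q) \<otimes> \<one> R) \<cdot> ((q X \<otimes> \<one> R) \<cdot> (r (X \<odot> Q) \<cdot> Q.F (\<aa> X Q R)))"
      by (subst Q.family_nat) (simp_all add: Q.Comp_whisker_right)
    also have "\<dots> = (((Q.F f \<otimes> \<one> Q) \<otimes> \<one> R) \<cdot> \<aa> (Q.FO X) Q R) \<cdot> qr X"
      unfolding Assoc_qr[OF X(1), symmetric] by simp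
    also have "\<dots> = ?a \<cdot> ((Q.F f \<otimes> \<one> (Q \<odot> R)) \<cdot> qr X)"
      using Q.Assoc_nat_left[of "Q.F f" "Q.FO X'" Q R, symmetric] by simp
    finally show "?a \<cdot> (qr X' \<cdot> Q.F (f \<otimes> \<one> (Q \<odot> R))) = ?a \<cdot> ((Q.F f \<otimes> \<one> (Q \<odot> R)) \<cdot> qr X)" .
  qed simp_all
qed

text \<open>Up to associativity, move \<open>q\<close> past \<open>r\<close> by
  naturality of \<open>r\<close>, then use the axiom for \<open>q\<close>, then the one for \<open>r\<close>.\<close>

lemma qr_mult2:
  assumes X [simp]: "X \<in> Obj C" and Y [simp]: "Y \<in> Obj C"
  shows "(mult2 T X Y \<otimes> \<one> (Q \<odot> R)) \<cdot> (qr (X \<odot> Q.FO Y)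
      \<cdot> (Q.F (\<aa> X (Q.FO Y) (Q \<odot> R)) \<cdot> Q.F (\<one> X \<otimes> qr Y)))
    = \<aa> (Q.FO X) (Q.FO Y) (Q \<odot> R) \<cdot> ((\<one> (Q.FO X) \<otimes> qr Y) \<cdot> mult2 T X (Y \<odot> (Q \<odot> R)))"
    (is "?lhs = ?rhs")
proof (rule Q.iso_cancel_left[OF Q.Assoc_iso[of "Q.FO X \<odot> Q.FO Y" Q R]])
  let ?TX = "Q.FO X" and ?TY = "Q.FO Y"
  let ?m = "(mult2 T X Y \<otimes> \<one> Q) \<otimes> \<one> R"
  let ?a = "\<aa> (?TX \<odot> ?TY) Q R"
  let ?rest = "Q.F (\<one> X \<otimes> r (Y \<odot> Q)) \<cdot> Q.F (\<one> X \<otimes> Q.F (\<aa> Y Q R))"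
  \<comment> \<open>Both sides use the pentagon in this form, once inside \<open>T\<close> and once outside.\<close>
  have pent: "\<aa> (Z \<odot> ?TY) Q R \<cdot> (\<aa> Z ?TY (Q \<odot> R) \<cdot> (\<one> Z \<otimes> qr Y))
      = (\<aa> Z ?TY Q \<otimes> \<one> R) \<cdot> (((\<one> Z \<otimes> q Y) \<otimes> \<one> R) \<cdot> (\<aa> Z (Q.FO (Y \<odot> Q)) R
          \<cdot> ((\<one> Z \<otimes> r (Y \<odot> Q)) \<cdot> (\<one> Z \<otimes> Q.F (\<aa> Y Q R)))))"
    if Z [simp]: "Z \<in> Obj C" for Z
  proof -
    have "\<aa> (Z \<odot> ?TY) Q R \<cdot> (\<aa> Z ?TY (Q \<odot> R) \<cdot> (\<one> Z \<otimes> qr Y))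
        = (\<aa> (Z \<odot> ?TY) Q R \<cdot> \<aa> Z ?TY (Q \<odot> R)) \<cdot> (\<one> Z \<otimes> qr Y)"
      by simp
    also have "\<dots> = (\<aa> Z ?TY Q \<otimes> \<one> R) \<cdot> (\<aa> Z (?TY \<odot> Q) R \<cdot> (\<one> Z \<otimes> (\<aa> ?TY Q R \<cdot> qr Y)))"
      by (subst Q.pentagon_right) (simp_all add: Q.Comp_whisker_left)
    also have "\<dots> = (\<aa> Z ?TY Q \<otimes> \<one> R) \<cdot> ((\<aa> Z (?TY \<odot> Q) R \<cdot> (\<one> Z \<otimes> (q Y \<otimes> \<one> R)))
        \<cdot> ((\<one> Z \<otimes> r (Y \<odot> Q)) \<cdot> (\<one> Z \<otimes> Q.F (\<aa> Y Q R))))"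
      unfolding Assoc_qr[OF Y] by (simp add: Q.Comp_whisker_left)
    also have "\<dots> = (\<aa> Z ?TY Q \<otimes> \<one> R) \<cdot> (((\<one> Z \<otimes> q Y) \<otimes> \<one> R) \<cdot> (\<aa> Z (Q.FO (Y \<odot> Q)) R
          \<cdot> ((\<one> Z \<otimes> r (Y \<odot> Q)) \<cdot> (\<one> Z \<otimes> Q.F (\<aa> Y Q R)))))"
      by (subst Q.Assoc_nat_middle) simp_all
    finally show ?thesis .
  qed
  have "?a \<cdot> ?lhs = (?a \<cdot> (mult2 T X Y \<otimes> \<one> (Q \<odot> R))) \<cdot> (qr (X \<odot> ?TY)
      \<cdot> (Q.F (\<aa> X ?TY (Q \<odot> R)) \<cdot> Q.F (\<one> X \<otimes> qr Y)))"
    by simp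
  also have "\<dots> = ?m \<cdot> ((\<aa> (Q.FO (X \<odot> ?TY)) Q R \<cdot> qr (X \<odot> ?TY))
      \<cdot> (Q.F (\<aa> X ?TY (Q \<odot> R)) \<cdot> Q.F (\<one> X \<otimes> qr Y)))"
    by (subst Q.Assoc_nat_left) simp_all
  also have "\<aa> (Q.FO (X \<odot> ?TY)) Q R \<cdot> qr (X \<odot> ?TY)
      = (q (X \<odot> ?TY) \<otimes> \<one> R) \<cdot> (r ((X \<odot> ?TY) \<odot> Q) \<cdot> Q.F (\<aa> (X \<odot> ?TY) Q R))"
    by (rule Assoc_qr) simp
  also have "?m \<cdot> (\<dots> \<cdot> (Q.F (\<aa> X ?TY (Q \<odot> R)) \<cdot> Q.F (\<one> X \<otimes> qr Y)))
      = ?m \<cdot> ((q (X \<odot> ?TY) \<otimes> \<one> R) \<cdot> (r ((X \<odot> ?TY) \<odot> Q)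
        \<cdot> Q.F (\<aa> (X \<odot> ?TY) Q R \<cdot> (\<aa> X ?TY (Q \<odot> R) \<cdot> (\<one> X \<otimes> qr Y)))))"
    by (simp add: Q.farr_Comp)
  also have "\<dots> = ?m \<cdot> ((q (X \<odot> ?TY) \<otimes> \<one> R) \<cdot> ((r ((X \<odot> ?TY) \<odot> Q)
        \<cdot> Q.F ((\<aa> X ?TY Q \<cdot> (\<one> X \<otimes> q Y)) \<otimes> \<one> R)) \<cdot> (Q.F (\<aa> X (Q.FO (Y \<odot> Q)) R) \<cdot> ?rest)))"
    unfolding pent[OF X] by (simp add: Q.farr_Comp Q.Comp_whisker_right)
  also have "\<dots> = (((mult2 T X Y \<otimes> \<one> Q) \<cdot> (q (X \<odot> ?TY) \<cdot> (Q.F (\<aa> X ?TY Q)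
        \<cdot> Q.F (\<one> X \<otimes> q Y)))) \<otimes> \<one> R)
      \<cdot> (r (X \<odot> Q.FO (Y \<odot> Q)) \<cdot> (Q.F (\<aa> X (Q.FO (Y \<odot> Q)) R) \<cdot> ?rest))"
    by (subst R.family_nat) (simp_all add: Q.farr_Comp Q.Comp_whisker_right)
  also have "\<dots> = (\<aa> ?TX ?TY Q \<otimes> \<one> R) \<cdot> (((\<one> ?TX \<otimes> q Y) \<otimes> \<one> R)
      \<cdot> (((mult2 T X (Y \<odot> Q) \<otimes> \<one> R) \<cdot> (r (X \<odot> Q.FO (Y \<odot> Q)) \<cdot> (Q.F (\<aa> X (Q.FO (Y \<odot> Q)) R)
        \<cdot> Q.F (\<one> X \<otimes> r (Y \<odot> Q))))) \<cdot> Q.F (\<one> X \<otimes> Q.F (\<aa> Y Q R))))"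
    by (subst Q.family_mult2_right) (simp_all add: Q.Comp_whisker_right)
  also have "\<dots> = (\<aa> ?TX ?TY Q \<otimes> \<one> R) \<cdot> (((\<one> ?TX \<otimes> q Y) \<otimes> \<one> R)
      \<cdot> (\<aa> ?TX (Q.FO (Y \<odot> Q)) R \<cdot> ((\<one> ?TX \<otimes> r (Y \<odot> Q))
        \<cdot> (mult2 T X ((Y \<odot> Q) \<odot> R) \<cdot> Q.F (\<one> X \<otimes> Q.F (\<aa> Y Q R))))))"
    by (subst R.family_mult2_right) simp_all
  also have "mult2 T X ((Y \<odot> Q) \<odot> R) \<cdot> Q.F (\<one> X \<otimes> Q.F (\<aa> Y Q R))
      = (\<one> ?TX \<otimes> Q.F (\<aa> Y Q R)) \<cdot> mult2 T X (Y \<odot> (Q \<odot> R))"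
    using Q.mult2_nat[of "\<one> X" "\<aa> Y Q R" X "(Y \<odot> Q) \<odot> R"] by simp
  also have "(\<aa> ?TX ?TY Q \<otimes> \<one> R) \<cdot> (((\<one> ?TX \<otimes> q Y) \<otimes> \<one> R)
      \<cdot> (\<aa> ?TX (Q.FO (Y \<odot> Q)) R \<cdot> ((\<one> ?TX \<otimes> r (Y \<odot> Q)) \<cdot> \<dots>)))
    = (?a \<cdot> (\<aa> ?TX ?TY (Q \<odot> R) \<cdot> (\<one> ?TX \<otimes> qr Y))) \<cdot> mult2 T X (Y \<odot> (Q \<odot> R))"
    by (subst pent) simp_all
  also have "\<dots> = ?a \<cdot> ?rhs"
    by simp
  finally show "?a \<cdot> ?lhs = ?a \<cdot> ?rhs" .
qed simp_all

lemma nonunital_tensor: "nonunital_module C T (Q \<odot> R) qr"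
proof
  show "Q \<odot> R \<in> Obj C" by simp
next
  fix X assume "X \<in> Obj C"
  then show "qr X \<in> hom C (Q.FO (X \<odot> (Q \<odot> R))) (Q.FO X \<odot> (Q \<odot> R))"
    by (simp add: Q.in_hom)
next
  fix f X X' assume "f \<in> hom C X X'"
  then show "qr X' \<cdot> Q.F (f \<otimes> \<one> (Q \<odot> R)) = (Q.F f \<otimes> \<one> (Q \<odot> R)) \<cdot> qr X"
    using qr_nat by (auto simp: Q.in_hom)
next
  fix X Y assume "X \<in> Obj C" "Y \<in> Obj C"
  then show "(mult2 T X Y \<otimes> \<one> (Q \<odot> R)) \<cdot> qr (X \<odot> Q.FO Y)
      \<cdot> Q.F (\<aa> X (Q.FO Y) (Q \<odot> R)) \<cdot> Q.F (\<one> X \<otimes> qr Y)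
    = \<aa> (Q.FO X) (Q.FO Y) (Q \<odot> R) \<cdot> (\<one> (Q.FO X) \<otimes> qr Y) \<cdot> mult2 T X (Y \<odot> (Q \<odot> R))"
    using qr_mult2[of X Y] by simp
qed

text \<open>The family \<open>q\<close> contributes only at \<open>\<I>\<close>, as in its own action; naturality of \<open>r\<close> along the
  left unit isomorphism of \<open>Q\<close> turns \<open>r\<close> at \<open>\<I> \<odot> Q\<close> into \<open>r\<close> at \<open>Q\<close>. For
  \<open>(T Q, mult2 T - Q)\<close> and \<open>(T R, mult2 T - R)\<close> the right-hand side is \<open>double_mult2 C T Q R\<close>.\<close>

lemma action_tensor: "Q.action (Q \<odot> R) qr = (Q.action Q q \<otimes> \<one> R) \<cdot> r Q"
proof -
  let ?i = "inv_arrow C (\<ll> (Q \<odot> R))" and ?TI = "Q.FO \<I>"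
  \<comment> \<open>This is \<open>Lunit_Tensor\<close>, solved for the inverses of the left unit isomorphisms.\<close>
  have i: "\<aa> \<I> Q R \<cdot> ?i = inv_arrow C (\<ll> Q) \<otimes> \<one> R"
  proof (rule Q.iso_cancel_left)
    show "iso_arrow C (\<ll> Q \<otimes> \<one> R)"
      by (intro Q.Tensor_iso Q.Lunit_iso Q.Ide_iso) simp_all
    have "(\<ll> Q \<otimes> \<one> R) \<cdot> (\<aa> \<I> Q R \<cdot> ?i) = \<ll> (Q \<odot> R) \<cdot> ?i"
      by (rule Q.Comp_extend) (simp_all add: Q.Lunit_Tensor)
    then show "(\<ll> Q \<otimes> \<one> R) \<cdot> (\<aa> \<I> Q R \<cdot> ?i) = (\<ll> Q \<otimes> \<one> R) \<cdot> (inv_arrow C (\<ll> Q) \<otimes> \<one> R)"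
      by (simp add: Q.interchange)
  qed simp_all
  have "Q.action (Q \<odot> R) qr = \<ll> (Q \<odot> R) \<cdot> ((mult0 T \<otimes> \<one> (Q \<odot> R)) \<cdot> (qr \<I> \<cdot> Q.F ?i))"
    by (simp add: Q.action_def)
  also have "\<dots> = ((\<ll> Q \<otimes> \<one> R) \<cdot> \<aa> \<I> Q R)
      \<cdot> ((mult0 T \<otimes> \<one> (Q \<odot> R)) \<cdot> (qr \<I> \<cdot> Q.F ?i))"
    by (subst Q.Lunit_Tensor) simp_all
  also have "\<dots> = (\<ll> Q \<otimes> \<one> R) \<cdot> ((\<aa> \<I> Q R \<cdot> (mult0 T \<otimes> \<one> (Q \<odot> R))) \<cdot> (qr \<I> \<cdot> Q.F ?i))"
    by simp
  also have "\<dots> = (\<ll> Q \<otimes> \<one> R) \<cdot> (((mult0 T \<otimes> \<one> Q) \<otimes> \<one> R) \<cdot> ((\<aa> ?TI Q R \<cdot> qr \<I>) \<cdot> Q.F ?i))"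
    by (subst Q.Assoc_nat_left) simp_all
  also have "\<dots> = (\<ll> Q \<otimes> \<one> R) \<cdot> (((mult0 T \<otimes> \<one> Q) \<otimes> \<one> R) \<cdot> ((q \<I> \<otimes> \<one> R)
      \<cdot> (r (\<I> \<odot> Q) \<cdot> Q.F (\<aa> \<I> Q R \<cdot> ?i))))"
    by (subst Assoc_qr) (simp_all add: Q.farr_Comp)
  also have "r (\<I> \<odot> Q) \<cdot> Q.F (\<aa> \<I> Q R \<cdot> ?i) = (Q.F (inv_arrow C (\<ll> Q)) \<otimes> \<one> R) \<cdot> r Q"
    unfolding i using R.family_nat[of "inv_arrow C (\<ll> Q)" "\<I> \<odot> Q"] by simp
  also have "(\<ll> Q \<otimes> \<one> R) \<cdot> (((mult0 T \<otimes> \<one> Q) \<otimes> \<one> R) \<cdot> ((q \<I> \<otimes> \<one> R) \<cdot> \<dots>))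
      = (Q.action Q q \<otimes> \<one> R) \<cdot> r Q"
    by (simp add: Q.action_def Q.Comp_whisker_right)
  finally show ?thesis .
qed

end

context left_multiplier_bimonad
begin

text \<open>The arrow \<open>g\<close> passes through \<open>r\<close> because it is a module morphism, \<open>f\<close> passes through \<open>q\<close> for
  the same reason and through \<open>r'\<close> by naturality.\<close>

lemma tensor_T_module_arrow:
  assumes "nonunital_module C T Q q" "nonunital_module C T R r"
    and "nonunital_module C T Q' q'" "nonunital_module C T R' r'"
    and f: "T_module_arrow C T (Q, q) f (Q', q')" and g: "T_module_arrow C T (R, r) g (R', r')"
  shows "T_module_arrow C T (Q \<odot> R, tensor_family Q q R r) (f \<otimes> g)
    (Q' \<odot> R', tensor_family Q' q' R' r')"
proof -
  interpret QR: nonunital_module_pair C T Q q R r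
    by (intro nonunital_module_pair.intro assms)
  interpret QR': nonunital_module_pair C T Q' q' R' r'
    by (intro nonunital_module_pair.intro assms)
  have [simp]: "f \<in> Arr C" "Dom C f = Q" "Cod C f = Q'" "g \<in> Arr C" "Dom C g = R" "Cod C g = R'"
    and f_eq: "\<And>X. X \<in> Obj C \<Longrightarrow> (\<one> (FO X) \<otimes> f) \<cdot> q X = q' X \<cdot> F (\<one> X \<otimes> f)"
    and g_eq: "\<And>X. X \<in> Obj C \<Longrightarrow> (\<one> (FO X) \<otimes> g) \<cdot> r X = r' X \<cdot> F (\<one> X \<otimes> g)"
    using f g by (auto simp: T_module_arrow_iff)
  have "(\<one> (FO X) \<otimes> (f \<otimes> g)) \<cdot> QR.qr X = QR'.qr X \<cdot> F (\<one> X \<otimes> (f \<otimes> g))"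
    if X [simp]: "X \<in> Obj C" for X
  proof (rule iso_cancel_left[OF Assoc_iso[of "FO X" Q' R']])
    let ?a = "\<aa> (FO X) Q' R'"
    have "?a \<cdot> ((\<one> (FO X) \<otimes> (f \<otimes> g)) \<cdot> QR.qr X) = (?a \<cdot> (\<one> (FO X) \<otimes> (f \<otimes> g))) \<cdot> QR.qr X"
      by simp
    also have "\<dots> = ((\<one> (FO X) \<otimes> f) \<otimes> g) \<cdot> (\<aa> (FO X) Q R \<cdot> QR.qr X)"
      by (subst Assoc_nat) simp_all
    also have "\<dots> = (((\<one> (FO X) \<otimes> f) \<otimes> g) \<cdot> (q X \<otimes> \<one> R)) \<cdot> (r (X \<odot> Q) \<cdot> F (\<aa> X Q R))"
      by (subst QR.Assoc_qr) simp_all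
    also have "((\<one> (FO X) \<otimes> f) \<otimes> g) \<cdot> (q X \<otimes> \<one> R)
        = (((\<one> (FO X) \<otimes> f) \<cdot> q X) \<otimes> \<one> R') \<cdot> (\<one> (FO (X \<odot> Q)) \<otimes> g)"
      by (simp add: interchange)
    also have "(\<one> (FO X) \<otimes> f) \<cdot> q X = q' X \<cdot> F (\<one> X \<otimes> f)"
      by (simp add: f_eq)
    also have "((q' X \<cdot> F (\<one> X \<otimes> f)) \<otimes> \<one> R') \<cdot> (\<one> (FO (X \<odot> Q)) \<otimes> g)
          \<cdot> (r (X \<odot> Q) \<cdot> F (\<aa> X Q R))
        = ((q' X \<cdot> F (\<one> X \<otimes> f)) \<otimes> \<one> R')
          \<cdot> (((\<one> (FO (X \<odot> Q)) \<otimes> g) \<cdot> r (X \<odot> Q)) \<cdot> F (\<aa> X Q R))"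
      by simp
    also have "(\<one> (FO (X \<odot> Q)) \<otimes> g) \<cdot> r (X \<odot> Q) = r' (X \<odot> Q) \<cdot> F (\<one> (X \<odot> Q) \<otimes> g)"
      by (simp add: g_eq)
    also have "((q' X \<cdot> F (\<one> X \<otimes> f)) \<otimes> \<one> R') \<cdot> (\<dots> \<cdot> F (\<aa> X Q R))
        = (q' X \<otimes> \<one> R') \<cdot> (((F (\<one> X \<otimes> f) \<otimes> \<one> R') \<cdot> r' (X \<odot> Q))
          \<cdot> (F (\<one> (X \<odot> Q) \<otimes> g) \<cdot> F (\<aa> X Q R)))"
      by (simp add: Comp_whisker_right)
    also have "(F (\<one> X \<otimes> f) \<otimes> \<one> R') \<cdot> r' (X \<odot> Q) = r' (X \<odot> Q') \<cdot> F ((\<one> X \<otimes> f) \<otimes> \<one> R')"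
      by (subst QR'.R.family_nat) simp_all
    also have "(q' X \<otimes> \<one> R') \<cdot> (\<dots> \<cdot> (F (\<one> (X \<odot> Q) \<otimes> g) \<cdot> F (\<aa> X Q R)))
        = (q' X \<otimes> \<one> R') \<cdot> (r' (X \<odot> Q') \<cdot> F (((\<one> X \<otimes> f) \<otimes> g) \<cdot> \<aa> X Q R))"
    proof -
      have "(\<one> X \<otimes> f) \<otimes> g = ((\<one> X \<otimes> f) \<otimes> \<one> R') \<cdot> (\<one> (X \<odot> Q) \<otimes> g)"
        by (simp add: interchange)
      then show ?thesis
        by (simp add: farr_Comp)
    qed
    also have "((\<one> X \<otimes> f) \<otimes> g) \<cdot> \<aa> X Q R = \<aa> X Q' R' \<cdot> (\<one> X \<otimes> (f \<otimes> g))"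
      by (subst Assoc_nat) simp_all
    also have "(q' X \<otimes> \<one> R') \<cdot> (r' (X \<odot> Q') \<cdot> F \<dots>)
        = (?a \<cdot> QR'.qr X) \<cdot> F (\<one> X \<otimes> (f \<otimes> g))"
      by (subst QR'.Assoc_qr) (simp_all add: farr_Comp)
    also have "\<dots> = ?a \<cdot> (QR'.qr X \<cdot> F (\<one> X \<otimes> (f \<otimes> g)))"
      by simp
    finally show "?a \<cdot> ((\<one> (FO X) \<otimes> (f \<otimes> g)) \<cdot> QR.qr X)
        = ?a \<cdot> (QR'.qr X \<cdot> F (\<one> X \<otimes> (f \<otimes> g)))" .
  qed simp_all
  then show ?thesis
    by (simp add: T_module_arrow_iff)
qed

lemma Ide_T_module_arrow:
  assumes "nonunital_module C T Q q"
  shows "T_module_arrow C T (Q, q) (\<one> Q) (Q, q)"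
proof -
  interpret Q: nonunital_module C T Q q by fact
  show ?thesis by (simp add: T_module_arrow_iff)
qed

lemma Comp_T_module_arrow:
  assumes "nonunital_module C T Q q" "nonunital_module C T R r" "nonunital_module C T S s"
    and f: "T_module_arrow C T (Q, q) f (R, r)" and g: "T_module_arrow C T (R, r) g (S, s)"
  shows "T_module_arrow C T (Q, q) (g \<cdot> f) (S, s)"
proof -
  interpret Q: nonunital_module C T Q q by fact
  interpret R: nonunital_module C T R r by fact
  interpret S: nonunital_module C T S s by fact
  have [simp]: "f \<in> Arr C" "Dom C f = Q" "Cod C f = R" "g \<in> Arr C" "Dom C g = R" "Cod C g = S"
    and f_eq: "\<And>X. X \<in> Obj C \<Longrightarrow> (\<one> (FO X) \<otimes> f) \<cdot> q X = r X \<cdot> F (\<one> X \<otimes> f)"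
    and g_eq: "\<And>X. X \<in> Obj C \<Longrightarrow> (\<one> (FO X) \<otimes> g) \<cdot> r X = s X \<cdot> F (\<one> X \<otimes> g)"
    using f g by (auto simp: T_module_arrow_iff)
  have "(\<one> (FO X) \<otimes> (g \<cdot> f)) \<cdot> q X = s X \<cdot> F (\<one> X \<otimes> (g \<cdot> f))" if X [simp]: "X \<in> Obj C" for X
  proof -
    have "(\<one> (FO X) \<otimes> (g \<cdot> f)) \<cdot> q X = (\<one> (FO X) \<otimes> g) \<cdot> ((\<one> (FO X) \<otimes> f) \<cdot> q X)"
      by (simp add: Comp_whisker_left)
    also have "\<dots> = ((\<one> (FO X) \<otimes> g) \<cdot> r X) \<cdot> F (\<one> X \<otimes> f)"
      by (simp add: f_eq)
    also have "\<dots> = s X \<cdot> F (\<one> X \<otimes> (g \<cdot> f))"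
      unfolding g_eq[OF X] by (simp add: Comp_whisker_left farr_Comp)
    finally show ?thesis .
  qed
  then show ?thesis
    by (simp add: T_module_arrow_iff)
qed

lemma inv_T_module_arrow:
  assumes "nonunital_module C T Q q" "nonunital_module C T R r"
    and f: "T_module_arrow C T (Q, q) f (R, r)" and iso: "iso_arrow C f"
  shows "T_module_arrow C T (R, r) (inv_arrow C f) (Q, q)"
proof -
  interpret Q: nonunital_module C T Q q by fact
  interpret R: nonunital_module C T R r by fact
  have [simp]: "f \<in> Arr C" "Dom C f = Q" "Cod C f = R"
    and f_eq: "\<And>X. X \<in> Obj C \<Longrightarrow> (\<one> (FO X) \<otimes> f) \<cdot> q X = r X \<cdot> F (\<one> X \<otimes> f)"
    using f by (auto simp: T_module_arrow_iff)
  let ?g = "inv_arrow C f"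
  have g [simp]: "?g \<in> Arr C" "Dom C ?g = R" "Cod C ?g = Q" "f \<cdot> ?g = \<one> R"
    using inv_arrow_simps[OF iso] by simp_all
  have "(\<one> (FO X) \<otimes> ?g) \<cdot> r X = q X \<cdot> F (\<one> X \<otimes> ?g)" if X [simp]: "X \<in> Obj C" for X
  proof (rule iso_cancel_left)
    show "iso_arrow C (\<one> (FO X) \<otimes> f)"
      using iso by (intro Tensor_iso Ide_iso) simp_all
    have "(\<one> (FO X) \<otimes> f) \<cdot> ((\<one> (FO X) \<otimes> ?g) \<cdot> r X) = \<one> (FO X \<odot> R) \<cdot> r X"
      by (rule Comp_extend) (simp_all add: interchange)
    also have "\<dots> = r X \<cdot> F ((\<one> X \<otimes> f) \<cdot> (\<one> X \<otimes> ?g))"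
      by (simp add: interchange)
    also have "\<dots> = (r X \<cdot> F (\<one> X \<otimes> f)) \<cdot> F (\<one> X \<otimes> ?g)"
      by (simp add: farr_Comp)
    also have "\<dots> = (\<one> (FO X) \<otimes> f) \<cdot> (q X \<cdot> F (\<one> X \<otimes> ?g))"
      unfolding f_eq[OF X, symmetric] by simp
    finally show "(\<one> (FO X) \<otimes> f) \<cdot> ((\<one> (FO X) \<otimes> ?g) \<cdot> r X)
        = (\<one> (FO X) \<otimes> f) \<cdot> (q X \<cdot> F (\<one> X \<otimes> ?g))" .
  qed simp_all
  then show ?thesis
    by (simp add: T_module_arrow_iff)
qed

lemma Lunit_T_module_arrow:
  assumes "nonunital_module C T Q q"
  shows "T_module_arrow C T (\<I> \<odot> Q, tensor_family \<I> unit_family Q q) (\<ll> Q) (Q, q)"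
proof -
  interpret IQ: nonunital_module_pair C T \<I> unit_family Q q
    by (intro nonunital_module_pair.intro nonunital_unit assms)
  have "(\<one> (FO X) \<otimes> \<ll> Q) \<cdot> IQ.qr X = q X \<cdot> F (\<one> X \<otimes> \<ll> Q)" if X [simp]: "X \<in> Obj C" for X
  proof -
    have "(\<one> (FO X) \<otimes> \<ll> Q) \<cdot> IQ.qr X = (\<rr> (FO X) \<otimes> \<one> Q) \<cdot> (\<aa> (FO X) \<I> Q \<cdot> IQ.qr X)"
      by (simp add: triangle[symmetric])
    also have "\<dots> = ((\<rr> (FO X) \<cdot> unit_family X) \<otimes> \<one> Q) \<cdot> (q (X \<odot> \<I>) \<cdot> F (\<aa> X \<I> Q))"
      by (subst IQ.Assoc_qr) (simp_all add: Comp_whisker_right del: unit_family_simps(4))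
    also have "\<dots> = ((F (\<rr> X) \<otimes> \<one> Q) \<cdot> q (X \<odot> \<I>)) \<cdot> F (\<aa> X \<I> Q)"
      by simp
    also have "(F (\<rr> X) \<otimes> \<one> Q) \<cdot> q (X \<odot> \<I>) = q X \<cdot> F (\<rr> X \<otimes> \<one> Q)"
      by (subst IQ.R.family_nat) simp_all
    also have "\<dots> \<cdot> F (\<aa> X \<I> Q) = q X \<cdot> F (\<one> X \<otimes> \<ll> Q)"
      by (simp add: triangle[symmetric] farr_Comp)
    finally show ?thesis .
  qed
  then show ?thesis
    by (simp add: T_module_arrow_iff)
qed

lemma Runit_T_module_arrow:
  assumes "nonunital_module C T Q q"
  shows "T_module_arrow C T (Q \<odot> \<I>, tensor_family Q q \<I> unit_family) (\<rr> Q) (Q, q)"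
proof -
  interpret QI: nonunital_module_pair C T Q q \<I> unit_family
    by (intro nonunital_module_pair.intro nonunital_unit assms)
  have "(\<one> (FO X) \<otimes> \<rr> Q) \<cdot> QI.qr X = q X \<cdot> F (\<one> X \<otimes> \<rr> Q)" if X [simp]: "X \<in> Obj C" for X
  proof -
    have "(\<one> (FO X) \<otimes> \<rr> Q) \<cdot> QI.qr X = \<rr> (FO X \<odot> Q) \<cdot> (\<aa> (FO X) Q \<I> \<cdot> QI.qr X)"
      by (simp add: Runit_Tensor[symmetric])
    also have "\<dots> = (\<rr> (FO X \<odot> Q) \<cdot> (q X \<otimes> \<one> \<I>)) \<cdot> (unit_family (X \<odot> Q) \<cdot> F (\<aa> X Q \<I>))"
      by (subst QI.Assoc_qr) simp_all
    also have "\<dots> = q X \<cdot> ((\<rr> (FO (X \<odot> Q)) \<cdot> unit_family (X \<odot> Q)) \<cdot> F (\<aa> X Q \<I>))"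
      by (subst Runit_nat) (simp_all del: unit_family_simps(4))
    also have "\<dots> = q X \<cdot> F (\<one> X \<otimes> \<rr> Q)"
      by (simp add: Runit_Tensor[symmetric] farr_Comp)
    finally show ?thesis .
  qed
  then show ?thesis
    by (simp add: T_module_arrow_iff)
qed

text \<open>Both threefold products use \<open>s\<close>, then \<open>r\<close>, then \<open>q\<close>; the two pentagons, for \<open>X\<close> and for
  \<open>T X\<close>, match their bracketings.\<close>

lemma Assoc_T_module_arrow:
  assumes "nonunital_module C T Q q" "nonunital_module C T R r" "nonunital_module C T S s"
  shows "T_module_arrow C T
    (Q \<odot> (R \<odot> S), tensor_family Q q (R \<odot> S) (tensor_family R r S s)) (\<aa> Q R S)
    ((Q \<odot> R) \<odot> S, tensor_family (Q \<odot> R) (tensor_family Q q R r) S s)"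
proof -
  interpret QR: nonunital_module_pair C T Q q R r
    by (intro nonunital_module_pair.intro assms)
  interpret RS: nonunital_module_pair C T R r S s
    by (intro nonunital_module_pair.intro assms)
  interpret Q_RS: nonunital_module_pair C T Q q "R \<odot> S" RS.qr
    by (intro nonunital_module_pair.intro RS.nonunital_tensor assms)
  interpret QR_S: nonunital_module_pair C T "Q \<odot> R" QR.qr S s
    by (intro nonunital_module_pair.intro QR.nonunital_tensor assms)
  have "(\<one> (FO X) \<otimes> \<aa> Q R S) \<cdot> Q_RS.qr X = QR_S.qr X \<cdot> F (\<one> X \<otimes> \<aa> Q R S)"
    if X [simp]: "X \<in> Obj C" for X
  proof (rule iso_cancel_left)
    let ?TX = "FO X"
    let ?a = "(\<aa> ?TX Q R \<otimes> \<one> S) \<cdot> \<aa> ?TX (Q \<odot> R) S"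
    show "iso_arrow C ?a"
      by (intro Comp_iso Tensor_iso Assoc_iso Ide_iso) simp_all
    have "?a \<cdot> ((\<one> ?TX \<otimes> \<aa> Q R S) \<cdot> Q_RS.qr X)
        = ((\<aa> ?TX Q R \<otimes> \<one> S) \<cdot> (\<aa> ?TX (Q \<odot> R) S \<cdot> (\<one> ?TX \<otimes> \<aa> Q R S))) \<cdot> Q_RS.qr X"
      by simp
    also have "\<dots> = \<aa> (?TX \<odot> Q) R S \<cdot> (\<aa> ?TX Q (R \<odot> S) \<cdot> Q_RS.qr X)"
      by (subst pentagon_right[symmetric]) simp_all
    also have "\<dots> = (\<aa> (?TX \<odot> Q) R S \<cdot> (q X \<otimes> \<one> (R \<odot> S)))
        \<cdot> (RS.qr (X \<odot> Q) \<cdot> F (\<aa> X Q (R \<odot> S)))"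
      by (subst Q_RS.Assoc_qr) simp_all
    also have "\<dots> = ((q X \<otimes> \<one> R) \<otimes> \<one> S)
        \<cdot> ((\<aa> (FO (X \<odot> Q)) R S \<cdot> RS.qr (X \<odot> Q)) \<cdot> F (\<aa> X Q (R \<odot> S)))"
      by (subst Assoc_nat_left) simp_all
    also have "\<dots> = ((q X \<otimes> \<one> R) \<otimes> \<one> S) \<cdot> ((r (X \<odot> Q) \<otimes> \<one> S)
        \<cdot> (s ((X \<odot> Q) \<odot> R) \<cdot> F (\<aa> (X \<odot> Q) R S \<cdot> \<aa> X Q (R \<odot> S))))"
      by (subst RS.Assoc_qr) (simp_all add: farr_Comp)
    also have "\<aa> (X \<odot> Q) R S \<cdot> \<aa> X Q (R \<odot> S)
        = (\<aa> X Q R \<otimes> \<one> S) \<cdot> (\<aa> X (Q \<odot> R) S \<cdot> (\<one> X \<otimes> \<aa> Q R S))"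
      by (rule pentagon_right) simp_all
    also have "((q X \<otimes> \<one> R) \<otimes> \<one> S) \<cdot> ((r (X \<odot> Q) \<otimes> \<one> S) \<cdot> (s ((X \<odot> Q) \<odot> R) \<cdot> F \<dots>))
        = ((q X \<otimes> \<one> R) \<otimes> \<one> S) \<cdot> ((r (X \<odot> Q) \<otimes> \<one> S) \<cdot> ((s ((X \<odot> Q) \<odot> R)
          \<cdot> F (\<aa> X Q R \<otimes> \<one> S)) \<cdot> (F (\<aa> X (Q \<odot> R) S) \<cdot> F (\<one> X \<otimes> \<aa> Q R S))))"
      by (simp add: farr_Comp)
    also have "\<dots> = (((q X \<otimes> \<one> R) \<cdot> (r (X \<odot> Q) \<cdot> F (\<aa> X Q R))) \<otimes> \<one> S)
        \<cdot> (s (X \<odot> (Q \<odot> R)) \<cdot> (F (\<aa> X (Q \<odot> R) S) \<cdot> F (\<one> X \<otimes> \<aa> Q R S)))"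
      by (subst RS.R.family_nat) (simp_all add: Comp_whisker_right)
    also have "(q X \<otimes> \<one> R) \<cdot> (r (X \<odot> Q) \<cdot> F (\<aa> X Q R)) = \<aa> ?TX Q R \<cdot> QR.qr X"
      by (simp add: QR.Assoc_qr)
    also have "(\<dots> \<otimes> \<one> S) \<cdot> (s (X \<odot> (Q \<odot> R)) \<cdot> (F (\<aa> X (Q \<odot> R) S) \<cdot> F (\<one> X \<otimes> \<aa> Q R S)))
        = (\<aa> ?TX Q R \<otimes> \<one> S) \<cdot> (((QR.qr X \<otimes> \<one> S)
          \<cdot> (s (X \<odot> (Q \<odot> R)) \<cdot> F (\<aa> X (Q \<odot> R) S))) \<cdot> F (\<one> X \<otimes> \<aa> Q R S))"
      by (simp add: Comp_whisker_right)
    also have "\<dots> = ?a \<cdot> (QR_S.qr X \<cdot> F (\<one> X \<otimes> \<aa> Q R S))"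
      unfolding QR_S.Assoc_qr[OF X, symmetric] by simp
    finally show "?a \<cdot> ((\<one> ?TX \<otimes> \<aa> Q R S) \<cdot> Q_RS.qr X)
        = ?a \<cdot> (QR_S.qr X \<cdot> F (\<one> X \<otimes> \<aa> Q R S))" .
  qed simp_all
  then show ?thesis
    by (simp add: T_module_arrow_iff)
qed

end

section \<open>The monoidal category of modules\<close>

locale split_left_multiplier_bimonad = left_multiplier_bimonad C T for C (structure) and T +
  assumes split_epi_mult0: "split_epi C (mult0 T)"
    and split_epi_double_mult2:
      "\<lbrakk>X \<in> Obj C; Y \<in> Obj C\<rbrakk> \<Longrightarrow> split_epi C (double_mult2 C T X Y)"
begin

lemma T_module_unit: "T_module C T \<I> unit_family"
proof -
  have "unit_family \<in> extensional (Obj C)"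
    by (simp add: unit_family_def)
  then show ?thesis
    by (simp add: T_module_iff action_unit nonunital_unit split_epi_mult0)
qed

text \<open>Equivariance of \<open>action Q q \<otimes> action R r\<close>, as a morphism from \<open>T Q \<odot> T R\<close> to \<open>Q \<odot> R\<close>, gives a
  commutative square in which this arrow and the action on its domain are split epimorphisms.\<close>

lemma T_module_tensor:
  assumes "T_module C T Q q" "T_module C T R r"
  shows "T_module C T (Q \<odot> R) (tensor_family Q q R r)"
proof -
  note Q = assms(1)[unfolded T_module_iff] and R = assms(2)[unfolded T_module_iff]
  interpret QR: nonunital_module_pair C T Q q R r
    using Q R by (intro nonunital_module_pair.intro) simp_all
  let ?mQ = "\<lambda>X. mult2 T X Q" and ?mR = "\<lambda>X. mult2 T X R"
  interpret F: nonunital_module_pair C T "FO Q" ?mQ "FO R" ?mR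
    by (intro nonunital_module_pair.intro nonunital_free) simp_all
  have double: "action (FO Q \<odot> FO R) F.qr = double_mult2 C T Q R"
    by (simp add: F.action_tensor) (simp add: action_def double_mult2_def Comp_whisker_right)
  let ?p = "action Q q \<otimes> action R r"
  have split: "split_epi C ?p"
  proof -
    obtain s t where st [simp]: "s \<in> Arr C" "Dom C s = Q" "Cod C s = FO Q" "action Q q \<cdot> s = \<one> Q"
      "t \<in> Arr C" "Dom C t = R" "Cod C t = FO R" "action R r \<cdot> t = \<one> R"
      using Q R by (auto simp: split_epi_def in_hom)
    have "?p \<cdot> (s \<otimes> t) = \<one> (Q \<odot> R)"
      by (simp add: interchange)
    then show ?thesis
      by (auto simp: split_epi_def in_hom intro!: bexI[of _ "s \<otimes> t"])
  qed
  interpret P: nonunital_module C T "Q \<odot> R" QR.qr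
    by (rule QR.nonunital_tensor)
  interpret FP: nonunital_module C T "FO Q \<odot> FO R" F.qr
    by (rule F.nonunital_tensor)
  have "T_module_arrow C T (FO Q \<odot> FO R, F.qr) ?p (Q \<odot> R, QR.qr)"
    by (intro tensor_T_module_arrow action_T_module_arrow nonunital_free)
      (use Q R in simp_all)
  then have "action (Q \<odot> R) QR.qr \<cdot> F ?p = ?p \<cdot> double_mult2 C T Q R"
    unfolding double[symmetric]
    by (intro action_natural[symmetric] QR.nonunital_tensor F.nonunital_tensor)
  then have action: "split_epi C (action (Q \<odot> R) QR.qr)"
    by (rule split_epi_descends[OF _ split split_epi_double_mult2])
      (simp_all flip: double)
  have "QR.qr \<in> extensional (Obj C)"
    by (simp add: tensor_family_def)
  with action show ?thesis
    by (simp add: T_module_iff QR.nonunital_tensor)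
qed

definition tensor_module :: "'a \<times> ('a \<Rightarrow> 'b) \<Rightarrow> 'a \<times> ('a \<Rightarrow> 'b) \<Rightarrow> 'a \<times> ('a \<Rightarrow> 'b)"
    (infixl "\<boxtimes>" 70) where
  "M \<boxtimes> N = (fst M \<odot> fst N, tensor_family (fst M) (snd M) (fst N) (snd N))"

abbreviation unit_module :: "'a \<times> ('a \<Rightarrow> 'b)" where
  "unit_module \<equiv> (\<I>, unit_family)"

definition T_modules_monoidal ::
  "('a \<times> ('a \<Rightarrow> 'b), ('a \<times> ('a \<Rightarrow> 'b)) \<times> 'b \<times> ('a \<times> ('a \<Rightarrow> 'b))) monoidal_cat" where
  "T_modules_monoidal = cat.extend (T_modules C T)
     (monoidal_cat.fields (\<boxtimes>)
       (\<lambda>(M, f, N) (M', f', N'). (M \<boxtimes> M', f \<otimes> f', N \<boxtimes> N'))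
       unit_module
       (\<lambda>M N P. (M \<boxtimes> (N \<boxtimes> P), \<aa> (fst M) (fst N) (fst P), (M \<boxtimes> N) \<boxtimes> P))
       (\<lambda>M. (unit_module \<boxtimes> M, \<ll> (fst M), M))
       (\<lambda>M. (M \<boxtimes> unit_module, \<rr> (fst M), M)))"

lemma truncate_T_modules_monoidal: "cat.truncate T_modules_monoidal = T_modules C T"
  by (simp add: T_modules_monoidal_def T_modules_def cat.defs)

lemma T_modules_monoidal_simps [simp]:
  "Dom T_modules_monoidal (M, f, N) = M"
  "Cod T_modules_monoidal (M, f, N) = N"
  "Ide T_modules_monoidal M = (M, \<one> (fst M), M)"
  "Comp T_modules_monoidal (N', g, P) (M, f, N) = (M, g \<cdot> f, P)"
  "TensorO T_modules_monoidal = (\<boxtimes>)"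
  "TensorA T_modules_monoidal (M, f, N) (M', f', N') = (M \<boxtimes> M', f \<otimes> f', N \<boxtimes> N')"
  "UnitO T_modules_monoidal = unit_module"
  "Assoc T_modules_monoidal M N P
    = (M \<boxtimes> (N \<boxtimes> P), \<aa> (fst M) (fst N) (fst P), (M \<boxtimes> N) \<boxtimes> P)"
  "Lunit T_modules_monoidal M = (unit_module \<boxtimes> M, \<ll> (fst M), M)"
  "Runit T_modules_monoidal M = (M \<boxtimes> unit_module, \<rr> (fst M), M)"
  by (simp_all add: T_modules_monoidal_def T_modules_def cat.defs monoidal_cat.defs)

abbreviation nonunital where "nonunital M \<equiv> nonunital_module C T (fst M) (snd M)"

lemma Obj_T_modules_monoidal:
  "M \<in> Obj T_modules_monoidal \<longleftrightarrow> T_module C T (fst M) (snd M)"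
  by (auto simp: T_modules_monoidal_def T_modules_def cat.defs)

lemma Obj_T_modules_monoidalD:
  assumes "M \<in> Obj T_modules_monoidal"
  shows "nonunital M" "fst M \<in> Obj C"
  using assms nonunital_module.carrier_Obj
  by (auto simp: Obj_T_modules_monoidal T_module_iff)

lemma Arr_T_modules_monoidal:
  "(M, f, N) \<in> Arr T_modules_monoidal \<longleftrightarrow>
    M \<in> Obj T_modules_monoidal \<and> N \<in> Obj T_modules_monoidal \<and> T_module_arrow C T M f N"
  by (auto simp: T_modules_monoidal_def T_modules_def cat.defs)

lemma hom_T_modules_monoidal:
  "x \<in> hom T_modules_monoidal M N \<longleftrightarrow> (\<exists>f. x = (M, f, N) \<and>
    M \<in> Obj T_modules_monoidal \<and> N \<in> Obj T_modules_monoidal \<and> T_module_arrow C T M f N)"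
  by (cases x) (auto simp: hom_def Arr_T_modules_monoidal)

lemma T_module_arrow_hom: "T_module_arrow C T M f N \<Longrightarrow> f \<in> hom C (fst M) (fst N)"
  by (cases M; cases N) (simp add: T_module_arrow_def)

lemma unit_module_Obj: "unit_module \<in> Obj T_modules_monoidal"
  by (simp add: Obj_T_modules_monoidal T_module_unit)

lemma tensor_module_Obj:
  "\<lbrakk>M \<in> Obj T_modules_monoidal; N \<in> Obj T_modules_monoidal\<rbrakk> \<Longrightarrow> M \<boxtimes> N \<in> Obj T_modules_monoidal"
  by (simp add: Obj_T_modules_monoidal tensor_module_def T_module_tensor)

lemma iso_arrow_T_modules_monoidal:
  assumes M: "M \<in> Obj T_modules_monoidal" and N: "N \<in> Obj T_modules_monoidal"
    and f: "T_module_arrow C T M f N" and iso: "iso_arrow C f"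
  shows "iso_arrow T_modules_monoidal (M, f, N)"
proof -
  have "T_module_arrow C T N (inv_arrow C f) M"
    using inv_T_module_arrow[of "fst M" "snd M" "fst N" "snd N" f] assms
      Obj_T_modules_monoidalD by simp
  then show ?thesis
    using assms inv_arrow_simps[OF iso] T_module_arrow_hom[OF f]
    unfolding iso_arrow_def inverse_arrows_def
    by (intro exI[of _ "(N, inv_arrow C f, M)"])
      (simp add: Arr_T_modules_monoidal hom_T_modules_monoidal in_hom)
qed

lemma structure_T_module_arrow:
  assumes "M \<in> Obj T_modules_monoidal" "N \<in> Obj T_modules_monoidal" "P \<in> Obj T_modules_monoidal"
  shows "T_module_arrow C T (M \<boxtimes> (N \<boxtimes> P)) (\<aa> (fst M) (fst N) (fst P)) ((M \<boxtimes> N) \<boxtimes> P)"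
    and "T_module_arrow C T (unit_module \<boxtimes> M) (\<ll> (fst M)) M"
    and "T_module_arrow C T (M \<boxtimes> unit_module) (\<rr> (fst M)) M"
  using Assoc_T_module_arrow[of "fst M" "snd M" "fst N" "snd N" "fst P" "snd P"]
    Lunit_T_module_arrow[of "fst M" "snd M"] Runit_T_module_arrow[of "fst M" "snd M"]
    Obj_T_modules_monoidalD assms
  by (simp_all add: tensor_module_def)

text \<open>Arrows of modules are determined by their domain, codomain and underlying arrow, so
  every equational axiom is the corresponding one of \<open>C\<close>.\<close>

lemma category_T_modules_monoidal: "category T_modules_monoidal"
proof
  fix f assume "f \<in> Arr T_modules_monoidal"
  then show "Dom T_modules_monoidal f \<in> Obj T_modules_monoidal"
    "Cod T_modules_monoidal f \<in> Obj T_modules_monoidal"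
    by (cases f; simp add: Arr_T_modules_monoidal)+
next
  fix M assume "M \<in> Obj T_modules_monoidal"
  then show "Ide T_modules_monoidal M \<in> hom T_modules_monoidal M M"
    using Ide_T_module_arrow[of "fst M" "snd M"]
    by (simp add: hom_T_modules_monoidal Obj_T_modules_monoidalD)
next
  fix f g M N P
  assume "f \<in> hom T_modules_monoidal M N" "g \<in> hom T_modules_monoidal N P"
  then show "Comp T_modules_monoidal g f \<in> hom T_modules_monoidal M P"
    using Comp_T_module_arrow[of "fst M" "snd M" "fst N" "snd N" "fst P" "snd P"]
    by (auto simp: hom_T_modules_monoidal Obj_T_modules_monoidalD)
qed (auto simp: hom_T_modules_monoidal in_hom dest!: T_module_arrow_hom)

lemma monoidal_category_T_modules_monoidal: "monoidal_category T_modules_monoidal"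
proof (intro monoidal_category.intro category_T_modules_monoidal monoidal_category_axioms.intro,
    goal_cases)
  \<comment> \<open>The cases are numbered as the axioms of \<open>monoidal_category\<close>: 2 says that the tensor
    product of arrows is an arrow, 7, 10 and 13 are invertibility of \<open>\<aa>\<close>, \<open>\<ll>\<close> and \<open>\<rr>\<close>, and the
    other cases treated here are equations in \<open>C\<close>.\<close>
  case (2 f M M' g N N')
  then show ?case
    using tensor_T_module_arrow[of "fst M" "snd M" "fst N" "snd N" "fst M'" "snd M'"
        "fst N'" "snd N'"]
    by (auto simp: hom_T_modules_monoidal Obj_T_modules_monoidalD tensor_module_Obj)
      (simp add: tensor_module_def)
next
  case (7 M N P)
  then show ?case
    by (auto intro!: iso_arrow_T_modules_monoidal tensor_module_Obj structure_T_module_arrow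
        Assoc_iso Obj_T_modules_monoidalD)
next
  case (10 M)
  then show ?case
    by (auto intro!: iso_arrow_T_modules_monoidal tensor_module_Obj unit_module_Obj
        structure_T_module_arrow Lunit_iso Obj_T_modules_monoidalD)
next
  case (13 M)
  then show ?case
    by (auto intro!: iso_arrow_T_modules_monoidal tensor_module_Obj unit_module_Obj
        structure_T_module_arrow Runit_iso Obj_T_modules_monoidalD)
next
  case (4 f M M' f' M'' g N N' g' N'')
  then show ?case
    by (auto simp: hom_T_modules_monoidal dest!: T_module_arrow_hom intro: TensorA_Comp)
next
  case (8 f M M' g N N' h P P')
  then show ?case
    by (auto simp: hom_T_modules_monoidal dest!: T_module_arrow_hom intro: Assoc_natural)
next
  case (11 f M M')
  then show ?case
    by (auto simp: hom_T_modules_monoidal dest!: T_module_arrow_hom intro: Lunit_natural)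
next
  case (14 f M M')
  then show ?case
    by (auto simp: hom_T_modules_monoidal dest!: T_module_arrow_hom intro: Runit_natural)
next
  case (15 M N P S)
  then show ?case
    using pentagon[of "fst M" "fst N" "fst P" "fst S"]
    by (simp add: tensor_module_def Obj_T_modules_monoidalD)
next
  case (16 M N)
  then show ?case
    using triangle[of "fst M" "fst N"]
    by (simp add: tensor_module_def Obj_T_modules_monoidalD)
qed (auto simp: hom_T_modules_monoidal tensor_module_Obj unit_module_Obj
    structure_T_module_arrow Obj_T_modules_monoidalD,
    simp_all add: tensor_module_def Obj_T_modules_monoidalD)

lemma strict_monoidal_forgetful: "strict_monoidal_functor T_modules_monoidal C forgetful"
proof (intro strict_monoidal_functor.intro functor_between.intro functor_between_axioms.intro
    strict_monoidal_functor_axioms.intro category_T_modules_monoidal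
    monoidal_category_T_modules_monoidal category_axioms monoidal_category_axioms)
qed (auto simp: forgetful_def tensor_module_def hom_T_modules_monoidal Obj_T_modules_monoidalD
    dest!: T_module_arrow_hom)

end

theorem theorem2p18:
  fixes C :: "('o, 'm) monoidal_cat"
    and T :: "('o, 'm) multiplier_bimonad"
  assumes "left_multiplier_bimonad C T"
    and "split_epi C (mult0 T)"
    and "\<And>X Y. \<lbrakk>X \<in> Obj C; Y \<in> Obj C\<rbrakk> \<Longrightarrow> split_epi C (double_mult2 C T X Y)"
  shows "\<exists>M :: ('o \<times> ('o \<Rightarrow> 'm), ('o \<times> ('o \<Rightarrow> 'm)) \<times> 'm \<times> ('o \<times> ('o \<Rightarrow> 'm))) monoidal_cat.
             cat.truncate M = T_modules C T \<and>
             monoidal_category M \<and>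
             strict_monoidal_functor M C forgetful"
proof -
  interpret split_left_multiplier_bimonad C T
    by (intro split_left_multiplier_bimonad.intro split_left_multiplier_bimonad_axioms.intro assms)
  show ?thesis
    using truncate_T_modules_monoidal monoidal_category_T_modules_monoidal
      strict_monoidal_forgetful
    by blast
qed

end
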